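(* Let $\{\xi_j\}_{j\in\mathbb Z}$ be i.i.d. zero-mean real random variables with $E[\xi_1^2]=\iota$ and $\sup_{t\ge0}t^{\alpha}P(\xi_1^2>t)<\infty$ for some $\alpha\in(1,2)$. Let $(c_l)_{l\ge 0}$ be real with $\sup_{l\ge 0}|l|^{\sigma}|c_l|<\infty$ for some $\sigma\in(\tfrac12,1]$, and let $x_k=\sum_{j=0}^{\infty}c_j\xi_{k-j}$. Fix an integer $h\ge 0$ and define $$\hat\gamma_h^{(n)}=\frac1n\sum_{k=1}^{n}x_kx_{k+h},\qquad \gamma_h=E[x_0x_h]=\iota\sum_{j=0}^{\infty}c_jc_{j+h}.$$ Then for every $p$ satisfying $p<\frac{1}{2-2\sigma}\wedge\alpha\wedge 2$, $$n^{1-\frac1p}\bigl[\hat\gamma_h^{(n)}-\gamma_h\bigr]\to 0\quad\text{almost surely as }n\to\infty.$$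
   Context: $a\wedge b=\min\{a,b\}$.
   Formalization: The exponent p is assumed positive (for p = 0 the rate is undefined and for p < 0 the claim fails in general); γ_h is taken to be the series ι Σ c_j c_{j+h}, and its equality with E[x_0 x_h] is not proved. *)

theory Defs
  imports "HOL-Probability.Probability"
begin

definition lin_proc :: "(nat \<Rightarrow> real) \<Rightarrow> (int \<Rightarrow> 'a \<Rightarrow> real) \<Rightarrow> int \<Rightarrow> 'a \<Rightarrow> real" where
  "lin_proc c \<xi> k \<omega> = (\<Sum>j. c j * \<xi> (k - int j) \<omega>)"

definition sample_autocov :: "(int \<Rightarrow> 'a \<Rightarrow> real) \<Rightarrow> nat \<Rightarrow> nat \<Rightarrow> 'a \<Rightarrow> real" where
  "sample_autocov x h n \<omega> = (1 / real n) * (\<Sum>k\<in>{1..int n}. x k \<omega> * x (k + int h) \<omega>)"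

end

theory Submission
  imports Defs "HOL-Real_Asymp.Real_Asymp"
begin

text \<open>
  Separating the terms with equal noise index splits the product of \<open>x\<^sub>k\<close> and \<open>x\<^bsub>k+h\<^esub>\<close>, after
  centring, into a diagonal part, which is a linear process with absolutely summable coefficients
  driven by the centred squares of the noise, and an off-diagonal quadratic form. The off-diagonal part needs
  only second moments of the noise: over a block of length \<open>n\<close> its variance is of order \<open>n\<close> to
  a power below \<open>2/p\<close>. The diagonal part has no variance, but the von Bahr--Esseen inequality
  bounds its \<open>q\<close>-th moment by a multiple of \<open>n\<close> for every \<open>q < \<alpha>\<close>. Dyadic chaining turns such
  block moment bounds into almost sure rates.
\<close>

section \<open>Dyadic chaining\<close>

text \<open>The tail hypothesis provides moments of the noise only below order 2 * \<alpha> < 4, so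
  a product of two values of the process need not have a variance. Products of two distinct noise
  variables do have one, by independence; this is what the split exploits. Each bound on
  \<open>p\<close> is the price of one part. Let \<open>e\<close> lie below 1 / p. The diagonal part
  needs a moment order q < \<alpha> with q * e > 1, whence p < \<alpha>. In the off-diagonal part
  the correlation between times \<open>k\<close> and \<open>l\<close> decays like |k - l| powr (-
  \<tau>) for \<tau> < 2 * \<sigma> - 1 and \<tau> <= 1/2; the resulting variance n powr (2 +
  \<epsilon> - 2 * \<tau>) has to stay below n powr (2 * e), which forces e > 2 - 2 * \<sigma> and e
  > 1/2. A second obstacle is convergence: \<open>c\<close> need not be absolutely summable, and
  \<open>lin_proc\<close> is a bare \<open>suminf\<close>, meaningless where its series diverges.
  Almost sure convergence is therefore proved separately, and the moment bounds are obtained for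
  noise restricted to finite windows and carried over by Fatou's lemma.\<close>

lemma dyadic_partial_sum_bound:
  fixes y :: "nat \<Rightarrow> real"
  assumes "\<And>s j. (j + 1) * 2 ^ s \<le> 2 ^ r \<Longrightarrow> \<bar>\<Sum>k\<in>{m + j * 2 ^ s..<m + (j + 1) * 2 ^ s}. y k\<bar> \<le> U"
    and "n \<le> 2 ^ r"
  shows "\<bar>\<Sum>k\<in>{m..<m + n}. y k\<bar> \<le> (real r + 1) * U"
  using assms
proof (induction r arbitrary: m n)
  case 0
  have U: "\<bar>y m\<bar> \<le> U"
    using 0(1)[of 0 0] by simp
  with 0(2) show ?case
    by (cases "n = 0") (auto simp: le_Suc_eq)
next
  case (Suc r)
  have U: "0 \<le> U"
    using Suc.prems(1)[of 0 0] by fastforce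
  \<comment> \<open>This follows the binary expansion of \<open>n\<close>: beyond 2 ^ r the first
    half is one block of level \<open>r\<close>, and the rest is a partial sum starting at m + 2 ^
    r. Each of the r + 1 levels thus costs at most one block, and the offset \<open>m\<close> must
    stay general in the induction.\<close>
  show ?case
  proof (cases "n \<le> 2 ^ r")
    case True
    have "\<bar>\<Sum>k\<in>{m..<m + n}. y k\<bar> \<le> (real r + 1) * U"
      by (rule Suc.IH[OF _ True]) (use Suc.prems(1) in \<open>auto intro: order_trans\<close>)
    also have "\<dots> \<le> (real (Suc r) + 1) * U"
      using U by (intro mult_right_mono) auto
    finally show ?thesis .
  next
    case False
    have split: "(\<Sum>k\<in>{m..<m + n}. y k) =
        (\<Sum>k\<in>{m..<m + 2 ^ r}. y k) + (\<Sum>k\<in>{m + 2 ^ r..<m + n}. y k)"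
      using False by (subst sum.atLeastLessThan_concat) auto
    have first: "\<bar>\<Sum>k\<in>{m..<m + 2 ^ r}. y k\<bar> \<le> U"
      using Suc.prems(1)[of 0 r] by simp
    have "\<bar>\<Sum>k\<in>{m + 2 ^ r..<(m + 2 ^ r) + (n - 2 ^ r)}. y k\<bar> \<le> (real r + 1) * U"
    proof (rule Suc.IH)
      fix s j :: nat
      assume le: "(j + 1) * 2 ^ s \<le> 2 ^ r"
      have "(2::nat) ^ s \<le> 2 ^ r"
        using le by (metis Suc_eq_plus1 le_add1 mult_Suc order_trans)
      then have "s \<le> r"
        by (simp add: power_increasing_iff)
      \<comment> \<open>Since 2 ^ s divides 2 ^ r, the dyadic blocks of the second half are dyadic
        blocks of the whole interval, renumbered.\<close>
      define i where "i = j + 2 ^ (r - s)"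
      have i: "i * 2 ^ s = j * 2 ^ s + 2 ^ r"
        using \<open>s \<le> r\<close> by (simp add: i_def algebra_simps flip: power_add)
      have "\<bar>\<Sum>k\<in>{m + i * 2 ^ s..<m + (i + 1) * 2 ^ s}. y k\<bar> \<le> U"
        by (rule Suc.prems(1)) (use le i in \<open>simp add: algebra_simps\<close>)
      moreover have "m + i * 2 ^ s = m + 2 ^ r + j * 2 ^ s"
        "m + (i + 1) * 2 ^ s = m + 2 ^ r + (j + 1) * 2 ^ s"
        using i by (simp_all add: algebra_simps)
      ultimately show "\<bar>\<Sum>k\<in>{m + 2 ^ r + j * 2 ^ s..<m + 2 ^ r + (j + 1) * 2 ^ s}. y k\<bar> \<le> U"
        by metis
    qed (use Suc.prems(2) in auto)
    moreover have "(m + 2 ^ r) + (n - 2 ^ r) = m + n"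
      using False by simp
    ultimately have "\<bar>\<Sum>k\<in>{m + 2 ^ r..<m + n}. y k\<bar> \<le> (real r + 1) * U"
      by simp
    with first show ?thesis
      unfolding split by (simp add: algebra_simps)
  qed
qed

lemma summable_powr_mult_geometric:
  fixes a \<delta> :: real
  assumes "\<delta> > 0"
  shows "summable (\<lambda>r. (real r + 1) powr a * 2 powr (- \<delta> * real r))"
proof (rule summable_comparison_test_bigo)
  show "summable (\<lambda>r. norm (real r powr (-2)))"
    by (simp add: summable_real_powr_iff)
  show "(\<lambda>r. (real r + 1) powr a * 2 powr (- \<delta> * real r)) \<in> O(\<lambda>r. real r powr (-2))"
    using assms by real_asymp
qed

text \<open>The moment of the maximum over a dyadic block costs only a power of the logarithm of its length.\<close>

lemma AE_normalised_partial_sums_tendsto_0: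
  fixes Y :: "nat \<Rightarrow> 'a \<Rightarrow> real"
  assumes [measurable]: "\<And>k. Y k \<in> borel_measurable M"
    and mom: "\<And>m n. (\<integral>\<^sup>+\<omega>. ennreal (\<bar>\<Sum>k\<in>{m..<m + n}. Y k \<omega>\<bar> powr q) \<partial>M) \<le> ennreal (K * real n powr \<beta>)"
    and q: "q > 0" and \<beta>: "1 \<le> \<beta>" "\<beta> < q * e" and K: "K \<ge> 0"
  shows "AE \<omega> in M. (\<lambda>n. real n powr (- e) * (\<Sum>k<n. Y k \<omega>)) \<longlonglongrightarrow> 0"
proof -
  have e: "e > 0"
    using q \<beta> by (smt (verit) mult_nonneg_nonpos)
  define B where "B s j \<omega> = (\<Sum>k\<in>{j * 2 ^ s..<(j + 1) * 2 ^ s}. Y k \<omega>)" for s j :: nat and \<omega>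
  \<comment> \<open>\<open>V r\<close> runs over all dyadic blocks inside the first 2 ^ r indices, a
    sum standing in for the maximum over blocks. \<open>T r\<close> then dominates the q-th power of
    the largest partial sum up to 2 ^ r, divided by 2 powr (e * r).\<close>
  define V where "V r \<omega> = (\<Sum>s\<le>r. \<Sum>j<2 ^ (r - s). \<bar>B s j \<omega>\<bar> powr q)" for r \<omega>
  define T where "T r \<omega> = 2 powr (- (q * e) * real r) * (real r + 1) powr q * V r \<omega>" for r \<omega>
  have [measurable]: "B s j \<in> borel_measurable M" for s j
    unfolding B_def by measurable
  have [measurable]: "V r \<in> borel_measurable M" "T r \<in> borel_measurable M" for r
    unfolding V_def T_def by measurable
  have V_nonneg: "V r \<omega> \<ge> 0" and T_nonneg: "T r \<omega> \<ge> 0" for r \<omega>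
    by (auto simp: V_def T_def intro!: sum_nonneg mult_nonneg_nonneg)
  have EB: "(\<integral>\<^sup>+\<omega>. ennreal (\<bar>B s j \<omega>\<bar> powr q) \<partial>M) \<le> ennreal (K * 2 powr (real s * \<beta>))" for s j
    using mom[of "j * 2 ^ s" "2 ^ s"] by (simp add: B_def algebra_simps powr_powr flip: powr_realpow)
  have EV: "(\<integral>\<^sup>+\<omega>. ennreal (V r \<omega>) \<partial>M) \<le> ennreal ((real r + 1) * (K * 2 powr (\<beta> * real r)))" for r
  proof -
    have "(\<integral>\<^sup>+\<omega>. ennreal (V r \<omega>) \<partial>M)
        = (\<Sum>s\<le>r. \<Sum>j<2 ^ (r - s). \<integral>\<^sup>+\<omega>. ennreal (\<bar>B s j \<omega>\<bar> powr q) \<partial>M)"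
      unfolding V_def by (simp add: sum_nonneg nn_integral_sum flip: sum_ennreal)
    also have "\<dots> \<le> (\<Sum>s\<le>r. \<Sum>j<(2::nat) ^ (r - s). ennreal (K * 2 powr (real s * \<beta>)))"
      by (intro sum_mono EB)
    also have "\<dots> = ennreal (\<Sum>s\<le>r. \<Sum>j<(2::nat) ^ (r - s). K * 2 powr (real s * \<beta>))"
      using K by (simp only: sum_ennreal sum_nonneg mult_nonneg_nonneg powr_ge_zero)
    also have "\<dots> \<le> ennreal (\<Sum>s\<le>r. K * 2 powr (\<beta> * real r))"
    proof (intro ennreal_leI sum_mono)
      fix s assume "s \<in> {..r}"
      then have s: "s \<le> r" by simp
      have "(\<Sum>j<(2::nat) ^ (r - s). K * 2 powr (real s * \<beta>)) = K * (2 powr (real (r - s)) * 2 powr (real s * \<beta>))"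
        by (simp add: powr_realpow)
      also have "\<dots> = K * 2 powr (real r - real s + real s * \<beta>)"
        using s by (simp add: powr_add of_nat_diff)
      also have "\<dots> \<le> K * 2 powr (\<beta> * real r)"
      proof (intro mult_left_mono powr_mono)
        \<comment> \<open>Here 1 <= \<beta> is what counts: the 2 ^ (r - s) blocks of level
          \<open>s\<close> together cost no more than the bound for a single block of length 2 ^ r.
          So every level contributes the same bound, and the levels only give the factor r +
          1.\<close>
        have "(real r - real s) * 1 \<le> (real r - real s) * \<beta>"
          using s \<beta>(1) by (intro mult_left_mono) auto
        then show "real r - real s + real s * \<beta> \<le> \<beta> * real r"
          by (simp add: algebra_simps)
      qed (use K in auto)
      finally show "(\<Sum>j<(2::nat) ^ (r - s). K * 2 powr (real s * \<beta>)) \<le> K * 2 powr (\<beta> * real r)" .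
    qed
    finally show ?thesis by (simp add: algebra_simps)
  qed
  have ET: "(\<integral>\<^sup>+\<omega>. ennreal (T r \<omega>) \<partial>M)
      \<le> ennreal (K * ((real r + 1) powr (q + 1) * 2 powr (- (q * e - \<beta>) * real r)))" for r
  proof -
    let ?a = "2 powr (- (q * e) * real r) * (real r + 1) powr q"
    have "(\<integral>\<^sup>+\<omega>. ennreal (T r \<omega>) \<partial>M) = ennreal ?a * (\<integral>\<^sup>+\<omega>. ennreal (V r \<omega>) \<partial>M)"
      unfolding T_def by (simp add: ennreal_mult V_nonneg nn_integral_cmult)
    also have "\<dots> \<le> ennreal ?a * ennreal ((real r + 1) * (K * 2 powr (\<beta> * real r)))"
      by (intro mult_left_mono EV) auto
    also have "\<dots> = ennreal (?a * ((real r + 1) * (K * 2 powr (\<beta> * real r))))"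
      using K by (intro ennreal_mult[symmetric]) auto
    also have "?a * ((real r + 1) * (K * 2 powr (\<beta> * real r)))
        = K * ((real r + 1) powr (q + 1) * 2 powr (- (q * e - \<beta>) * real r))"
    proof -
      have "(real r + 1) powr (q + 1) = (real r + 1) powr q * (real r + 1)"
        by (simp add: powr_add)
      moreover have "2 powr (- (q * e - \<beta>) * real r) = 2 powr (- (q * e) * real r) * 2 powr (\<beta> * real r)"
        by (simp add: algebra_simps flip: powr_add)
      ultimately show ?thesis by (simp add: algebra_simps)
    qed
    finally show ?thesis .
  qed
  have "(\<integral>\<^sup>+\<omega>. (\<Sum>r. ennreal (T r \<omega>)) \<partial>M) = (\<Sum>r. \<integral>\<^sup>+\<omega>. ennreal (T r \<omega>) \<partial>M)"
    by (rule nn_integral_suminf) measurable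
  also have "\<dots> \<le> (\<Sum>r. ennreal (K * ((real r + 1) powr (q + 1) * 2 powr (- (q * e - \<beta>) * real r))))"
    by (intro suminf_le ET) auto
  also have "\<dots> < \<infinity>"
  proof -
    have "summable (\<lambda>r. K * ((real r + 1) powr (q + 1) * 2 powr (- (q * e - \<beta>) * real r)))"
      using \<beta> by (intro summable_mult summable_powr_mult_geometric) auto
    then show ?thesis
      using K by (subst suminf_ennreal2) (auto simp: top.not_eq_extremum)
  qed
  \<comment> \<open>A finite expectation of the whole series makes \<open>T r\<close> tend to 0
    almost surely, which takes the place of a Borel-Cantelli argument.\<close>
  finally have "AE \<omega> in M. (\<Sum>r. ennreal (T r \<omega>)) \<noteq> \<infinity>"
    by (intro nn_integral_PInf_AE) auto
  then show ?thesis
  proof eventually_elim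
    case (elim \<omega>)
    then have "summable (\<lambda>r. T r \<omega>)"
      using T_nonneg by (intro summable_suminf_not_top) auto
    then have T_lim: "(\<lambda>r. T r \<omega>) \<longlonglongrightarrow> 0"
      by (rule summable_LIMSEQ_zero)
    show ?case
    proof (rule LIMSEQ_I)
      fix \<epsilon> :: real assume \<epsilon>: "\<epsilon> > 0"
      \<comment> \<open>For 2 ^ r <= n < 2 ^ Suc r the chaining uses level \<open>Suc r\<close>
        while the normalisation only gives 2 ^ r; the factor 2 powr (- (q * e)) pays for this
        mismatch.\<close>
      define \<epsilon>' where "\<epsilon>' = 2 powr (- (q * e)) * \<epsilon> powr q"
      have "\<epsilon>' > 0" using \<epsilon> by (simp add: \<epsilon>'_def)
      from LIMSEQ_D[OF T_lim this] obtain R where R: "\<And>r. r \<ge> R \<Longrightarrow> T r \<omega> < \<epsilon>'"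
        using T_nonneg by auto
      show "\<exists>no. \<forall>n\<ge>no. norm (real n powr (- e) * (\<Sum>k<n. Y k \<omega>) - 0) < \<epsilon>"
      proof (intro exI[of _ "2 ^ R"] allI impI)
        fix n :: nat assume n: "n \<ge> 2 ^ R"
        then have "n > 0" by (metis less_le_trans zero_less_numeral zero_less_power)
        then obtain r where r: "2 ^ r \<le> n" "n < 2 ^ Suc r"
          using ex_power_ivl1[of 2 n] by auto
        have "(2::nat) ^ R < 2 ^ Suc r" using n r by linarith
        then have "R \<le> r" using power_less_imp_less_exp[of "2::nat" R "Suc r"] by simp
        \<comment> \<open>Every single block is bounded by the l^q norm of all of them, so this one
          number serves as the uniform block bound.\<close>
        define U where "U = V (Suc r) \<omega> powr (1 / q)"
        have "\<bar>\<Sum>k\<in>{0 + j * 2 ^ s..<0 + (j + 1) * 2 ^ s}. Y k \<omega>\<bar> \<le> U"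
          if le: "(j + 1) * 2 ^ s \<le> 2 ^ Suc r" for s j :: nat
        proof -
          have "(2::nat) ^ s \<le> 2 ^ Suc r"
            using le by (metis Suc_eq_plus1 le_add1 mult_Suc order_trans)
          then have s: "s \<le> Suc r" by (simp only: power_increasing_iff[of "2::nat"])
          have "(j + 1) * 2 ^ s \<le> 2 ^ (Suc r - s) * (2::nat) ^ s"
            using le s by (simp only: flip: power_add) auto
          then have j: "j < 2 ^ (Suc r - s)"
            unfolding mult_le_cancel2 by simp
          have "\<bar>B s j \<omega>\<bar> powr q \<le> (\<Sum>j<2 ^ (Suc r - s). \<bar>B s j \<omega>\<bar> powr q)"
            using j by (intro member_le_sum) auto
          also have "\<dots> \<le> V (Suc r) \<omega>"
            unfolding V_def using s
            by (intro member_le_sum[where f = "\<lambda>s. \<Sum>j<2 ^ (Suc r - s). \<bar>B s j \<omega>\<bar> powr q"])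
              (auto intro: sum_nonneg)
          finally have "(\<bar>B s j \<omega>\<bar> powr q) powr (1 / q) \<le> U"
            unfolding U_def using q by (intro powr_mono2) auto
          then show ?thesis
            using q by (simp add: powr_powr B_def)
        qed
        then have "\<bar>\<Sum>k\<in>{0..<0 + n}. Y k \<omega>\<bar> \<le> (real (Suc r) + 1) * U"
          by (rule dyadic_partial_sum_bound) (use r in auto)
        then have "\<bar>\<Sum>k<n. Y k \<omega>\<bar> powr q \<le> ((real (Suc r) + 1) * U) powr q"
          using q by (intro powr_mono2) (auto simp: atLeast0LessThan)
        also have "\<dots> = (real (Suc r) + 1) powr q * V (Suc r) \<omega>"
          using q V_nonneg[of "Suc r" \<omega>] by (simp add: powr_mult U_def powr_powr)
        finally have S: "\<bar>\<Sum>k<n. Y k \<omega>\<bar> powr q \<le> (real (Suc r) + 1) powr q * V (Suc r) \<omega>" .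
        have "\<bar>real n powr (- e) * (\<Sum>k<n. Y k \<omega>)\<bar> powr q
            = real n powr (- (q * e)) * \<bar>\<Sum>k<n. Y k \<omega>\<bar> powr q"
          by (simp add: abs_mult powr_mult powr_powr mult.commute)
        also have "\<dots> \<le> (2 powr real r) powr (- (q * e)) * ((real (Suc r) + 1) powr q * V (Suc r) \<omega>)"
        proof (intro mult_mono S powr_mono2')
          show "2 powr real r \<le> real n"
          proof -
            have "real (2 ^ r) \<le> real n"
              using r(1) by (simp only: of_nat_le_iff)
            then show ?thesis by (simp add: powr_realpow)
          qed
        qed (use q e V_nonneg in auto)
        also have "(2 powr real r) powr (- (q * e)) = 2 powr (q * e) * 2 powr (- (q * e) * real (Suc r))"
          by (simp add: powr_powr algebra_simps flip: powr_add)
        also have "\<dots> * ((real (Suc r) + 1) powr q * V (Suc r) \<omega>) = 2 powr (q * e) * T (Suc r) \<omega>"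
          by (simp only: T_def mult.assoc)
        also have "\<dots> < 2 powr (q * e) * \<epsilon>'"
          using R[of "Suc r"] \<open>R \<le> r\<close> by (intro mult_strict_left_mono) auto
        also have "\<dots> = \<epsilon> powr q"
          unfolding \<epsilon>'_def mult.assoc[symmetric] powr_add[symmetric] by simp
        finally show "norm (real n powr (- e) * (\<Sum>k<n. Y k \<omega>) - 0) < \<epsilon>"
          using q \<epsilon> by (smt (verit) powr_mono2 real_norm_def)
      qed
    qed
  qed
qed

section \<open>Moment inequalities\<close>

text \<open>After scaling to u + v = 1 it reduces to x <= x powr s on [0, 1], applied to both
  shares.\<close>

lemma powr_subadditive:
  fixes u v s :: real
  assumes "0 \<le> u" "0 \<le> v" "0 < s" "s \<le> 1"
  shows "(u + v) powr s \<le> u powr s + v powr s"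
proof (cases "u + v = 0")
  case False
  then have pos: "u + v > 0" using assms by simp
  have scaled: "x * (u + v) powr s \<le> (x * (u + v)) powr s" if "0 \<le> x" "x \<le> 1" for x
  proof -
    have "x powr 1 \<le> x powr s"
      using that assms by (intro powr_mono') auto
    then show ?thesis
      using that pos by (simp add: powr_mult mult_right_mono)
  qed
  have "(u + v) powr s = u / (u + v) * (u + v) powr s + v / (u + v) * (u + v) powr s"
    using pos by (simp flip: distrib_right add_divide_distrib)
  also have "\<dots> \<le> (u / (u + v) * (u + v)) powr s + (v / (u + v) * (u + v)) powr s"
    using assms pos by (intro add_mono scaled) (auto simp: divide_simps)
  finally show ?thesis using pos by simp
qed (use assms in auto)

text \<open>With s = q - 1 the function is the derivative of |x| powr q divided by \<open>q\<close>,
  so this is Hoelder continuity of a gradient. For equal signs it is subadditivity; for opposite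
  signs |u| and |v| are both at most |u - v|, which produces the factor 2.\<close>

lemma sgn_powr_Hoelder:
  fixes u v s :: real
  assumes "0 < s" "s \<le> 1"
  shows "\<bar>sgn u * \<bar>u\<bar> powr s - sgn v * \<bar>v\<bar> powr s\<bar> \<le> 2 * \<bar>u - v\<bar> powr s"
proof -
  have same: "\<bar>\<bar>u\<bar> powr s - \<bar>v\<bar> powr s\<bar> \<le> \<bar>u - v\<bar> powr s" for u v :: real
  proof -
    have *: "\<bar>u\<bar> powr s \<le> \<bar>v\<bar> powr s + \<bar>u - v\<bar> powr s" for u v :: real
    proof -
      have "\<bar>u\<bar> powr s \<le> (\<bar>v\<bar> + \<bar>u - v\<bar>) powr s"
        using assms by (intro powr_mono2) auto
      also have "\<dots> \<le> \<bar>v\<bar> powr s + \<bar>u - v\<bar> powr s"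
        using assms by (intro powr_subadditive) auto
      finally show ?thesis .
    qed
    from *[of u v] *[of v u] show ?thesis
      unfolding abs_minus_commute[of v u] by linarith
  qed
  show ?thesis
  proof (cases "sgn u * sgn v < 0")
    case True
    then have "\<bar>u - v\<bar> = \<bar>u\<bar> + \<bar>v\<bar>"
      by (auto simp: sgn_if split: if_splits)
    then have "\<bar>u\<bar> powr s \<le> \<bar>u - v\<bar> powr s" "\<bar>v\<bar> powr s \<le> \<bar>u - v\<bar> powr s"
      using assms by (auto intro!: powr_mono2)
    moreover have "\<bar>sgn u * \<bar>u\<bar> powr s - sgn v * \<bar>v\<bar> powr s\<bar> \<le> \<bar>u\<bar> powr s + \<bar>v\<bar> powr s"
      by (rule order_trans[OF abs_triangle_ineq4]) (auto simp: abs_mult sgn_if)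
    ultimately show ?thesis by simp
  next
    case False
    then have "\<bar>sgn u * \<bar>u\<bar> powr s - sgn v * \<bar>v\<bar> powr s\<bar> = \<bar>\<bar>u\<bar> powr s - \<bar>v\<bar> powr s\<bar>"
      by (auto simp: sgn_if split: if_splits)
    also note same[of u v]
    finally show ?thesis
      by (smt (verit) powr_ge_zero)
  qed
qed

text \<open>Convexity of |x| powr q: the graph lies above its tangent at \<open>x\<close>. Young's
  inequality with the conjugate exponents \<open>q\<close> and q / (q - 1) gives this without
  differentiating.\<close>

lemma powr_abs_tangent:
  fixes x y q :: real
  assumes "1 < q"
  shows "\<bar>x\<bar> powr q + q * (sgn x * \<bar>x\<bar> powr (q - 1)) * (y - x) \<le> \<bar>y\<bar> powr q"
proof (cases "x = 0")
  case False
  have "\<bar>y\<bar> * \<bar>x\<bar> powr (q - 1) \<le> \<bar>y\<bar> powr q / q + (\<bar>x\<bar> powr (q - 1)) powr (q / (q - 1)) / (q / (q - 1))"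
    using assms by (intro Youngs_inequality) (auto simp: field_simps)
  also have "(\<bar>x\<bar> powr (q - 1)) powr (q / (q - 1)) / (q / (q - 1)) = (q - 1) / q * \<bar>x\<bar> powr q"
    using assms by (simp add: powr_powr)
  finally have "q * (\<bar>y\<bar> * \<bar>x\<bar> powr (q - 1)) \<le> \<bar>y\<bar> powr q + (q - 1) * \<bar>x\<bar> powr q"
    using assms by (simp add: field_simps)
  moreover have "q * (sgn x * y * \<bar>x\<bar> powr (q - 1)) \<le> q * (\<bar>y\<bar> * \<bar>x\<bar> powr (q - 1))"
    using assms by (intro mult_left_mono mult_right_mono) (auto simp: sgn_if)
  moreover have "sgn x * x * \<bar>x\<bar> powr (q - 1) = \<bar>x\<bar> powr q"
    using False powr_add[of "\<bar>x\<bar>" 1 "q - 1"] by (simp add: sgn_if)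
  ultimately show ?thesis
    by (simp add: algebra_simps)
qed (use assms in simp)

text \<open>A first-order Taylor bound whose remainder has order \<open>q\<close> instead of 2. The
  tangent at a + b is evaluated at \<open>a\<close>, and Hoelder continuity moves the gradient from
  a + b back to \<open>a\<close>. The term linear in \<open>b\<close> is the one that vanishes in
  expectation for independent centred \<open>b\<close>.\<close>

lemma powr_abs_add_le:
  fixes a b q :: real
  assumes "1 < q" "q \<le> 2"
  shows "\<bar>a + b\<bar> powr q \<le> \<bar>a\<bar> powr q + q * (sgn a * \<bar>a\<bar> powr (q - 1)) * b + 2 * q * \<bar>b\<bar> powr q"
proof -
  let ?g = "\<lambda>x::real. sgn x * \<bar>x\<bar> powr (q - 1)"
  have "(?g (a + b) - ?g a) * b \<le> \<bar>?g (a + b) - ?g a\<bar> * \<bar>b\<bar>"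
    by (metis abs_ge_self abs_mult)
  also have "\<dots> \<le> (2 * \<bar>(a + b) - a\<bar> powr (q - 1)) * \<bar>b\<bar>"
    using assms by (intro mult_right_mono sgn_powr_Hoelder) auto
  also have "\<dots> = 2 * \<bar>b\<bar> powr q"
    using powr_add[of "\<bar>b\<bar>" 1 "q - 1"] by (cases "b = 0") simp_all
  finally have "q * ((?g (a + b) - ?g a) * b) \<le> q * (2 * \<bar>b\<bar> powr q)"
    using assms by (intro mult_left_mono) auto
  with powr_abs_tangent[OF assms(1), of "a + b" a] show ?thesis
    by (simp add: algebra_simps)
qed

lemma abs_le_1_plus_powr:
  fixes x q r :: real
  assumes "0 \<le> r" "r \<le> q"
  shows "\<bar>x\<bar> powr r \<le> 1 + \<bar>x\<bar> powr q"
proof (cases "\<bar>x\<bar> \<le> 1")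
  case True
  then have "\<bar>x\<bar> powr r \<le> 1"
    using assms by (simp add: powr_le1)
  then show ?thesis by (smt (verit) powr_ge_zero)
next
  case False
  then have "\<bar>x\<bar> powr r \<le> \<bar>x\<bar> powr q"
    using assms by (intro powr_mono) auto
  then show ?thesis by simp
qed

lemma abs_diff_powr_le:
  fixes x y q :: real
  assumes "0 \<le> q"
  shows "\<bar>x - y\<bar> powr q \<le> 2 powr q * (\<bar>x\<bar> powr q + \<bar>y\<bar> powr q)"
proof -
  have "\<bar>x - y\<bar> powr q \<le> (2 * max \<bar>x\<bar> \<bar>y\<bar>) powr q"
    using assms by (intro powr_mono2) auto
  also have "\<dots> = 2 powr q * max \<bar>x\<bar> \<bar>y\<bar> powr q"
    by (simp add: powr_mult)
  also have "\<dots> \<le> 2 powr q * (\<bar>x\<bar> powr q + \<bar>y\<bar> powr q)"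
    by (intro mult_left_mono) (auto simp: max_def)
  finally show ?thesis .
qed

text \<open>Fatou's lemma, in the form that carries a moment bound uniform over finite windows of
  the noise to the infinite series.\<close>

lemma nn_integral_powr_le_of_tendsto:
  fixes W :: "'a \<Rightarrow> real"
  assumes [measurable]: "\<And>N. WN N \<in> borel_measurable M" and "0 < q"
    and lim: "AE \<omega> in M. (\<lambda>N. WN N \<omega>) \<longlonglongrightarrow> W \<omega>"
    and B: "\<And>N. (\<integral>\<^sup>+\<omega>. ennreal (\<bar>WN N \<omega>\<bar> powr q) \<partial>M) \<le> B"
  shows "(\<integral>\<^sup>+\<omega>. ennreal (\<bar>W \<omega>\<bar> powr q) \<partial>M) \<le> B"
proof -
  have "(\<integral>\<^sup>+\<omega>. ennreal (\<bar>W \<omega>\<bar> powr q) \<partial>M) = (\<integral>\<^sup>+\<omega>. liminf (\<lambda>N. ennreal (\<bar>WN N \<omega>\<bar> powr q)) \<partial>M)"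
  proof (rule nn_integral_cong_AE, use lim in eventually_elim)
    case (elim \<omega>)
    have "(\<lambda>N. ennreal (\<bar>WN N \<omega>\<bar> powr q)) \<longlonglongrightarrow> ennreal (\<bar>W \<omega>\<bar> powr q)"
      using \<open>0 < q\<close> by (intro tendsto_ennrealI tendsto_powr' tendsto_rabs elim tendsto_const) auto
    then show ?case
      using lim_imp_Liminf[OF sequentially_bot] by metis
  qed
  also have "\<dots> \<le> liminf (\<lambda>N. \<integral>\<^sup>+\<omega>. ennreal (\<bar>WN N \<omega>\<bar> powr q) \<partial>M)"
    by (rule nn_integral_liminf) measurable
  also have "\<dots> \<le> liminf (\<lambda>N. B)"
    by (intro Liminf_mono always_eventually allI B)
  also have "\<dots> = B"
    by (simp add: Liminf_const)
  finally show ?thesis .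
qed

context prob_space
begin

text \<open>Cutting the range of \<open>X\<close> at powers of 2 bounds the moment by a geometric
  series of ratio 2 powr (q - \<alpha>), which is below 1 because q < \<alpha>.\<close>

lemma integrable_powr_of_tail_bound:
  fixes X :: "'a \<Rightarrow> real"
  assumes [measurable]: "X \<in> borel_measurable M" and nonneg: "\<And>\<omega>. 0 \<le> X \<omega>"
    and tail: "\<And>t. 0 \<le> t \<Longrightarrow> t powr \<alpha> * prob {\<omega>\<in>space M. X \<omega> > t} \<le> C" and q: "0 < q" "q < \<alpha>"
  shows "integrable M (\<lambda>\<omega>. X \<omega> powr q)"
proof -
  define E where "E r = {\<omega>\<in>space M. X \<omega> > 2 ^ r}" for r :: nat
  have [measurable]: "E r \<in> sets M" for r
    unfolding E_def by measurable
  have "0 \<le> C" using tail[of 0] q by simp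
  have le: "ennreal (X \<omega> powr q) \<le> 1 + (\<Sum>r. ennreal ((2 ^ Suc r) powr q) * indicator (E r) \<omega>)" if "\<omega> \<in> space M" for \<omega>
  proof (cases "X \<omega> \<le> 1")
    case True
    then have "ennreal (X \<omega> powr q) \<le> 1"
      using nonneg q by (simp add: powr_le1)
    then show ?thesis
      by (simp add: add_increasing2)
  next
    case False
    have ex: "\<exists>r. X \<omega> \<le> 2 ^ r"
      using real_arch_pow[of 2 "X \<omega>"] by (auto intro: less_imp_le)
    \<comment> \<open>Minimality puts \<open>X \<omega>\<close> between 2 ^ s and 2 ^ Suc s, where r
      = Suc s is positive because \<open>X \<omega>\<close> exceeds 1; the term with index
      \<open>s\<close> alone then dominates.\<close>
    define r where "r = (LEAST r. X \<omega> \<le> 2 ^ r)"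
    have r: "X \<omega> \<le> 2 ^ r" unfolding r_def using ex by (rule LeastI_ex)
    then obtain s where s: "r = Suc s"
      using False by (cases r) auto
    have "\<not> X \<omega> \<le> 2 ^ s"
      using s not_less_Least[of s "\<lambda>r. X \<omega> \<le> 2 ^ r"] unfolding r_def by simp
    then have "\<omega> \<in> E s" using that by (simp add: E_def)
    have "ennreal (X \<omega> powr q) \<le> ennreal ((2 ^ Suc s) powr q)"
      using r s nonneg q by (intro ennreal_leI powr_mono2) auto
    also have "\<dots> = (\<Sum>r\<in>{s}. ennreal ((2 ^ Suc r) powr q) * indicator (E r) \<omega>)"
      using \<open>\<omega> \<in> E s\<close> by simp
    also have "\<dots> \<le> (\<Sum>r. ennreal ((2 ^ Suc r) powr q) * indicator (E r) \<omega>)"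
      by (intro sum_le_suminf) auto
    finally show ?thesis
      by (simp add: add_increasing)
  qed
  have bound: "(2 ^ Suc r) powr q * prob (E r) \<le> 2 powr q * C * (2 powr (q - \<alpha>)) ^ r" for r
  proof -
    have pow: "(2::real) ^ k = 2 powr real k" for k
      by (simp add: powr_realpow)
    have "(2 powr real r) powr \<alpha> * prob (E r) \<le> C"
      using tail[of "2 ^ r"] by (simp add: E_def pow)
    then have "(2 powr (real r * \<alpha>)) * prob (E r) \<le> C"
      by (simp add: powr_powr)
    then have "prob (E r) \<le> C * 2 powr (- (real r * \<alpha>))"
      by (simp add: powr_minus field_simps)
    then have "(2 ^ Suc r) powr q * prob (E r) \<le> 2 powr (real (Suc r) * q) * (C * 2 powr (- (real r * \<alpha>)))"
      unfolding pow powr_powr by (intro mult_left_mono) auto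
    also have "\<dots> = C * 2 powr (q + real r * (q - \<alpha>))"
      by (simp add: algebra_simps flip: powr_add)
    also have "\<dots> = 2 powr q * C * (2 powr (q - \<alpha>)) powr (real r)"
      by (simp add: powr_add powr_powr mult.commute)
    finally show ?thesis by (simp add: powr_realpow)
  qed
  have "(\<integral>\<^sup>+\<omega>. ennreal (X \<omega> powr q) \<partial>M)
      \<le> (\<integral>\<^sup>+\<omega>. 1 + (\<Sum>r. ennreal ((2 ^ Suc r) powr q) * indicator (E r) \<omega>) \<partial>M)"
    by (intro nn_integral_mono le)
  also have "\<dots> = 1 + (\<Sum>r. ennreal ((2 ^ Suc r) powr q) * emeasure M (E r))"
    by (simp add: nn_integral_add nn_integral_suminf nn_integral_cmult_indicator emeasure_space_1)
  also have "\<dots> \<le> 1 + (\<Sum>r. ennreal (2 powr q * C * (2 powr (q - \<alpha>)) ^ r))"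
  proof (intro add_left_mono suminf_le)
    fix r
    have "ennreal ((2 ^ Suc r) powr q) * emeasure M (E r) = ennreal ((2 ^ Suc r) powr q * prob (E r))"
      by (simp add: emeasure_eq_measure ennreal_mult)
    also have "\<dots> \<le> ennreal (2 powr q * C * (2 powr (q - \<alpha>)) ^ r)"
      by (intro ennreal_leI bound)
    finally show "ennreal ((2 ^ Suc r) powr q) * emeasure M (E r) \<le> ennreal (2 powr q * C * (2 powr (q - \<alpha>)) ^ r)" .
  qed auto
  also have "\<dots> < \<infinity>"
  proof -
    have "(2::real) powr (q - \<alpha>) < 1"
      using powr_less_mono[of "q - \<alpha>" 0 2] q by simp
    then have "summable (\<lambda>r. 2 powr q * C * (2 powr (q - \<alpha>)) ^ r)"
      by (intro summable_mult summable_geometric) auto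
    then have "(\<Sum>r. ennreal (2 powr q * C * (2 powr (q - \<alpha>)) ^ r)) < \<infinity>"
      using \<open>0 \<le> C\<close> by (subst suminf_ennreal2) auto
    then show ?thesis by simp
  qed
  finally show ?thesis
    by (intro integrableI_bounded) auto
qed

lemma integrable_powr_mono:
  fixes X :: "'a \<Rightarrow> real"
  assumes [measurable]: "X \<in> borel_measurable M" and "integrable M (\<lambda>\<omega>. \<bar>X \<omega>\<bar> powr q)"
    and "0 \<le> r" "r \<le> q"
  shows "integrable M (\<lambda>\<omega>. \<bar>X \<omega>\<bar> powr r)"
proof (rule Bochner_Integration.integrable_bound)
  show "integrable M (\<lambda>\<omega>. 1 + \<bar>X \<omega>\<bar> powr q)"
    by (intro Bochner_Integration.integrable_add assms(2)) simp
  show "AE \<omega> in M. norm (\<bar>X \<omega>\<bar> powr r) \<le> norm (1 + \<bar>X \<omega>\<bar> powr q)"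
    using abs_le_1_plus_powr[OF assms(3,4)] by (simp add: add_nonneg_nonneg)
qed measurable

lemma integrable_of_powr:
  fixes X :: "'a \<Rightarrow> real"
  assumes [measurable]: "X \<in> borel_measurable M" and "integrable M (\<lambda>\<omega>. \<bar>X \<omega>\<bar> powr q)" and "1 \<le> q"
  shows "integrable M X"
  by (rule integrable_abs_cancel) (use integrable_powr_mono[OF assms(1,2), of 1] assms(3) in simp_all)

text \<open>In the pointwise Taylor bound the linear term is a function of \<open>X\<close> times
  \<open>Y\<close>, so independence and the zero mean of \<open>Y\<close> remove it. The coefficient
  of E |X| powr q stays exactly 1, which allows iteration.\<close>

lemma expectation_powr_add_le:
  fixes X Y :: "'a \<Rightarrow> real"
  assumes q: "1 < q" "q \<le> 2"
    and indep: "indep_var borel X borel Y"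
    and X: "integrable M (\<lambda>\<omega>. \<bar>X \<omega>\<bar> powr q)" and Y: "integrable M (\<lambda>\<omega>. \<bar>Y \<omega>\<bar> powr q)"
    and mean: "expectation Y = 0"
  shows "integrable M (\<lambda>\<omega>. \<bar>X \<omega> + Y \<omega>\<bar> powr q)"
    and "expectation (\<lambda>\<omega>. \<bar>X \<omega> + Y \<omega>\<bar> powr q)
      \<le> expectation (\<lambda>\<omega>. \<bar>X \<omega>\<bar> powr q) + 2 * q * expectation (\<lambda>\<omega>. \<bar>Y \<omega>\<bar> powr q)"
proof -
  have [measurable]: "X \<in> borel_measurable M" "Y \<in> borel_measurable M"
    using indep_var_rv1[OF indep] indep_var_rv2[OF indep] by auto
  let ?g = "\<lambda>x::real. q * (sgn x * \<bar>x\<bar> powr (q - 1))"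
  have intY: "integrable M Y"
    by (rule integrable_of_powr[OF _ Y]) (use q in auto)
  have "integrable M (\<lambda>\<omega>. q * \<bar>X \<omega>\<bar> powr (q - 1))"
    using q by (intro integrable_mult_right integrable_powr_mono[OF _ X]) auto
  then have intg: "integrable M (\<lambda>\<omega>. ?g (X \<omega>))"
    by (rule Bochner_Integration.integrable_bound) (use q in \<open>auto simp: abs_mult sgn_if\<close>)
  have "indep_var borel (?g \<circ> X) borel ((\<lambda>y. y) \<circ> Y)"
    by (rule indep_var_compose[OF indep]) measurable
  then have indep_g: "indep_var borel (\<lambda>\<omega>. ?g (X \<omega>)) borel Y"
    by (simp only: comp_def)
  have prod: "integrable M (\<lambda>\<omega>. ?g (X \<omega>) * Y \<omega>)" "expectation (\<lambda>\<omega>. ?g (X \<omega>) * Y \<omega>) = 0"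
    using indep_var_integrable[OF indep_g intg intY] indep_var_lebesgue_integral[OF indep_g intg intY] mean
    by auto
  let ?R = "\<lambda>\<omega>. \<bar>X \<omega>\<bar> powr q + ?g (X \<omega>) * Y \<omega> + 2 * q * \<bar>Y \<omega>\<bar> powr q"
  have R: "integrable M ?R"
    by (intro Bochner_Integration.integrable_add integrable_mult_right X Y prod)
  have le: "\<bar>X \<omega> + Y \<omega>\<bar> powr q \<le> ?R \<omega>" for \<omega>
    using powr_abs_add_le[OF q] by simp
  show int: "integrable M (\<lambda>\<omega>. \<bar>X \<omega> + Y \<omega>\<bar> powr q)"
  proof (rule Bochner_Integration.integrable_bound[OF R])
    show "AE \<omega> in M. norm (\<bar>X \<omega> + Y \<omega>\<bar> powr q) \<le> norm (?R \<omega>)"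
    proof (intro always_eventually allI)
      fix \<omega>
      show "norm (\<bar>X \<omega> + Y \<omega>\<bar> powr q) \<le> norm (?R \<omega>)"
        using le[of \<omega>] powr_ge_zero[of "\<bar>X \<omega> + Y \<omega>\<bar>" q] unfolding real_norm_def by linarith
    qed
  qed measurable
  have "expectation (\<lambda>\<omega>. \<bar>X \<omega> + Y \<omega>\<bar> powr q) \<le> expectation ?R"
    by (intro integral_mono int R le)
  also have "\<dots> = expectation (\<lambda>\<omega>. \<bar>X \<omega>\<bar> powr q) + 2 * q * expectation (\<lambda>\<omega>. \<bar>Y \<omega>\<bar> powr q)"
    using X Y prod by simp
  finally show "expectation (\<lambda>\<omega>. \<bar>X \<omega> + Y \<omega>\<bar> powr q)
      \<le> expectation (\<lambda>\<omega>. \<bar>X \<omega>\<bar> powr q) + 2 * q * expectation (\<lambda>\<omega>. \<bar>Y \<omega>\<bar> powr q)" .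
qed

section \<open>Independent sums and off-diagonal quadratic forms\<close>

lemma indep_var_restrict_singleton:
  fixes Z :: "'i \<Rightarrow> 'a \<Rightarrow> real"
  assumes indep: "indep_vars (\<lambda>_. borel) Z I" and F: "F \<subseteq> I" "N \<in> I" "N \<notin> F"
    and G: "G \<in> borel_measurable (PiM F (\<lambda>_. borel))" and H: "H \<in> borel_measurable borel"
  shows "indep_var borel (\<lambda>\<omega>. G (restrict (\<lambda>a. Z a \<omega>) F)) borel (\<lambda>\<omega>. H (Z N \<omega>))"
proof -
  have "indep_var borel (G \<circ> (\<lambda>\<omega>. restrict (\<lambda>a. Z a \<omega>) F))
      borel ((\<lambda>f. H (f N)) \<circ> (\<lambda>\<omega>. restrict (\<lambda>a. Z a \<omega>) {N}))"
    using F H by (intro indep_var_compose[OF indep_var_restrict[OF indep] G]) auto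
  then show ?thesis by (simp add: comp_def)
qed

text \<open>Variables are added one at a time; the factor 2 * q is charged to the new summand only,
  so it does not compound. At q = 2 this also serves as the variance bound, with constant 4 in place
  of 1.\<close>

lemma von_Bahr_Esseen:
  fixes Z :: "'i \<Rightarrow> 'a \<Rightarrow> real"
  assumes q: "1 < q" "q \<le> 2" and "finite F" "F \<subseteq> I" and indep: "indep_vars (\<lambda>_. borel) Z I"
    and Z: "\<And>a. a \<in> I \<Longrightarrow> integrable M (\<lambda>\<omega>. \<bar>Z a \<omega>\<bar> powr q)" "\<And>a. a \<in> I \<Longrightarrow> expectation (Z a) = 0"
    and K: "\<And>a. a \<in> I \<Longrightarrow> expectation (\<lambda>\<omega>. \<bar>Z a \<omega>\<bar> powr q) \<le> K"
  shows "integrable M (\<lambda>\<omega>. \<bar>\<Sum>a\<in>F. w a * Z a \<omega>\<bar> powr q)"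
    and "expectation (\<lambda>\<omega>. \<bar>\<Sum>a\<in>F. w a * Z a \<omega>\<bar> powr q) \<le> 2 * q * K * (\<Sum>a\<in>F. \<bar>w a\<bar> powr q)"
proof -
  have "integrable M (\<lambda>\<omega>. \<bar>\<Sum>a\<in>F. w a * Z a \<omega>\<bar> powr q) \<and>
    expectation (\<lambda>\<omega>. \<bar>\<Sum>a\<in>F. w a * Z a \<omega>\<bar> powr q) \<le> 2 * q * K * (\<Sum>a\<in>F. \<bar>w a\<bar> powr q)"
    using \<open>finite F\<close> \<open>F \<subseteq> I\<close>
  proof (induction F rule: finite_induct)
    case (insert N F)
    let ?S = "\<lambda>\<omega>. \<Sum>a\<in>F. w a * Z a \<omega>"
    have "indep_var borel (\<lambda>\<omega>. (\<lambda>f. \<Sum>a\<in>F. w a * f a) (restrict (\<lambda>a. Z a \<omega>) F))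
        borel (\<lambda>\<omega>. w N * Z N \<omega>)"
      using insert by (intro indep_var_restrict_singleton[OF indep]) auto
    then have ind: "indep_var borel ?S borel (\<lambda>\<omega>. w N * Z N \<omega>)"
      by simp
    have N: "integrable M (\<lambda>\<omega>. \<bar>w N * Z N \<omega>\<bar> powr q)" "expectation (\<lambda>\<omega>. w N * Z N \<omega>) = 0"
      using Z[of N] insert.prems by (auto simp: abs_mult powr_mult)
    have S: "integrable M (\<lambda>\<omega>. \<bar>?S \<omega>\<bar> powr q)"
      "expectation (\<lambda>\<omega>. \<bar>?S \<omega>\<bar> powr q) \<le> 2 * q * K * (\<Sum>a\<in>F. \<bar>w a\<bar> powr q)"
      using insert by auto
    have "2 * q * expectation (\<lambda>\<omega>. \<bar>w N * Z N \<omega>\<bar> powr q) = 2 * q * \<bar>w N\<bar> powr q * expectation (\<lambda>\<omega>. \<bar>Z N \<omega>\<bar> powr q)"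
      by (simp add: abs_mult powr_mult)
    also have "\<dots> \<le> 2 * q * \<bar>w N\<bar> powr q * K"
      using K[of N] insert.prems q by (intro mult_left_mono) auto
    finally have "2 * q * expectation (\<lambda>\<omega>. \<bar>w N * Z N \<omega>\<bar> powr q) \<le> 2 * q * \<bar>w N\<bar> powr q * K" .
    with expectation_powr_add_le[OF q ind S(1) N] S(2) insert.hyps show ?case
      by (simp add: add.commute algebra_simps)
  qed simp
  then show "integrable M (\<lambda>\<omega>. \<bar>\<Sum>a\<in>F. w a * Z a \<omega>\<bar> powr q)"
    and "expectation (\<lambda>\<omega>. \<bar>\<Sum>a\<in>F. w a * Z a \<omega>\<bar> powr q) \<le> 2 * q * K * (\<Sum>a\<in>F. \<bar>w a\<bar> powr q)"
    by auto
qed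

corollary von_Bahr_Esseen_nn_integral:
  fixes Z :: "'i \<Rightarrow> 'a \<Rightarrow> real"
  assumes "1 < q" "q \<le> 2" "finite F" "F \<subseteq> I" "indep_vars (\<lambda>_. borel) Z I"
    and "\<And>a. a \<in> I \<Longrightarrow> integrable M (\<lambda>\<omega>. \<bar>Z a \<omega>\<bar> powr q)" "\<And>a. a \<in> I \<Longrightarrow> expectation (Z a) = 0"
    and "\<And>a. a \<in> I \<Longrightarrow> expectation (\<lambda>\<omega>. \<bar>Z a \<omega>\<bar> powr q) \<le> K"
  shows "(\<integral>\<^sup>+\<omega>. ennreal (\<bar>\<Sum>a\<in>F. w a * Z a \<omega>\<bar> powr q) \<partial>M) \<le> ennreal (2 * q * K * (\<Sum>a\<in>F. \<bar>w a\<bar> powr q))"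
  using von_Bahr_Esseen[of q F I Z K w] assms by (subst nn_integral_eq_integral) (auto intro: ennreal_leI)

text \<open>Adding an index \<open>N\<close> turns the form into S + L * Z N with \<open>S\<close>
  quadratic and \<open>L\<close> linear in the old variables. Independence kills the cross term and
  factors the second moment of L * Z N, so no fourth moment ever appears. The constant 8 is 4 from
  the variance bound for \<open>L\<close> times 2 from (x + y)^2 <= 2 x^2 + 2 y^2.\<close>

lemma expectation_quadratic_form_square_le:
  fixes Z :: "'i \<Rightarrow> 'a \<Rightarrow> real" and A :: "'i \<Rightarrow> 'i \<Rightarrow> real"
  assumes "finite F" "F \<subseteq> I" and indep: "indep_vars (\<lambda>_. borel) Z I"
    and Z: "\<And>a. a \<in> I \<Longrightarrow> integrable M (\<lambda>\<omega>. (Z a \<omega>)\<^sup>2)" "\<And>a. a \<in> I \<Longrightarrow> expectation (Z a) = 0"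
    and v: "\<And>a. a \<in> I \<Longrightarrow> expectation (\<lambda>\<omega>. (Z a \<omega>)\<^sup>2) \<le> v"
    and diag: "\<And>a. A a a = 0"
  shows "integrable M (\<lambda>\<omega>. (\<Sum>a\<in>F. \<Sum>b\<in>F. A a b * Z a \<omega> * Z b \<omega>)\<^sup>2)"
    and "expectation (\<lambda>\<omega>. (\<Sum>a\<in>F. \<Sum>b\<in>F. A a b * Z a \<omega> * Z b \<omega>)\<^sup>2) \<le> 8 * v\<^sup>2 * (\<Sum>a\<in>F. \<Sum>b\<in>F. (A a b)\<^sup>2)"
proof -
  let ?Q = "\<lambda>F \<omega>. \<Sum>a\<in>F. \<Sum>b\<in>F. A a b * Z a \<omega> * Z b \<omega>"
  have "integrable M (\<lambda>\<omega>. (?Q F \<omega>)\<^sup>2) \<and> expectation (\<lambda>\<omega>. (?Q F \<omega>)\<^sup>2) \<le> 8 * v\<^sup>2 * (\<Sum>a\<in>F. \<Sum>b\<in>F. (A a b)\<^sup>2)"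
    using \<open>finite F\<close> \<open>F \<subseteq> I\<close>
  proof (induction F rule: finite_induct)
    case (insert N F)
    have N: "N \<in> I" and F: "F \<subseteq> I" using insert.prems by auto
    have meas: "Z a \<in> borel_measurable M" if "a \<in> I" for a
      using indep that by (simp add: indep_vars_def)
    have measF: "Z a \<in> borel_measurable M" if "a \<in> F" for a
      using meas F that by blast
    note meas[OF N, measurable]
    have "0 \<le> v"
      by (rule order_trans[OF _ v[OF N]]) simp
    let ?S = "?Q F" and ?L = "\<lambda>\<omega>. \<Sum>a\<in>F. (A a N + A N a) * Z a \<omega>"
    have [measurable]: "?S \<in> borel_measurable M" "?L \<in> borel_measurable M"
      by (intro borel_measurable_sum borel_measurable_times borel_measurable_const measF; assumption)+
    have S: "integrable M (\<lambda>\<omega>. (?S \<omega>)\<^sup>2)"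
      "expectation (\<lambda>\<omega>. (?S \<omega>)\<^sup>2) \<le> 8 * v\<^sup>2 * (\<Sum>a\<in>F. \<Sum>b\<in>F. (A a b)\<^sup>2)"
      using insert.IH F by auto
    have L: "integrable M (\<lambda>\<omega>. (?L \<omega>)\<^sup>2)"
      "expectation (\<lambda>\<omega>. (?L \<omega>)\<^sup>2) \<le> 4 * v * (\<Sum>a\<in>F. (A a N + A N a)\<^sup>2)"
      using von_Bahr_Esseen[of 2 F I Z v "\<lambda>a. A a N + A N a"] insert.hyps F indep Z v by simp_all
    have SL: "integrable M (\<lambda>\<omega>. ?S \<omega> * ?L \<omega>)"
    proof (rule Bochner_Integration.integrable_bound)
      show "integrable M (\<lambda>\<omega>. (?S \<omega>)\<^sup>2 + (?L \<omega>)\<^sup>2)"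
        using S L by simp
      have "\<bar>x * y\<bar> \<le> x\<^sup>2 + y\<^sup>2" for x y :: real
      proof -
        have "2 * \<bar>x * y\<bar> \<le> x\<^sup>2 + y\<^sup>2"
          using sum_squares_bound[of "\<bar>x\<bar>" "\<bar>y\<bar>"] by (simp add: abs_mult)
        then show ?thesis using abs_ge_zero[of "x * y"] by linarith
      qed
      then show "AE \<omega> in M. norm (?S \<omega> * ?L \<omega>) \<le> norm ((?S \<omega>)\<^sup>2 + (?L \<omega>)\<^sup>2)"
        by simp
    qed measurable
    have ZN: "integrable M (Z N)"
      using square_integrable_imp_integrable[of "Z N"] N Z(1)[OF N] by simp
    have "indep_var borel (\<lambda>\<omega>. (\<lambda>f. (\<Sum>a\<in>F. \<Sum>b\<in>F. A a b * f a * f b) * (\<Sum>a\<in>F. (A a N + A N a) * f a)) (restrict (\<lambda>a. Z a \<omega>) F))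
        borel (\<lambda>\<omega>. Z N \<omega>)"
      using insert.hyps N F by (intro indep_var_restrict_singleton[OF indep]) auto
    then have ind1: "indep_var borel (\<lambda>\<omega>. ?S \<omega> * ?L \<omega>) borel (Z N)"
      by (simp cong: sum.cong)
    have "indep_var borel (\<lambda>\<omega>. (\<lambda>f. (\<Sum>a\<in>F. (A a N + A N a) * f a)\<^sup>2) (restrict (\<lambda>a. Z a \<omega>) F))
        borel (\<lambda>\<omega>. (Z N \<omega>)\<^sup>2)"
      using insert.hyps N F by (intro indep_var_restrict_singleton[OF indep]) auto
    then have ind2: "indep_var borel (\<lambda>\<omega>. (?L \<omega>)\<^sup>2) borel (\<lambda>\<omega>. (Z N \<omega>)\<^sup>2)"
      by (simp cong: sum.cong)
    have cross: "integrable M (\<lambda>\<omega>. ?S \<omega> * ?L \<omega> * Z N \<omega>)" "expectation (\<lambda>\<omega>. ?S \<omega> * ?L \<omega> * Z N \<omega>) = 0"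
      using indep_var_integrable[OF ind1 SL ZN] indep_var_lebesgue_integral[OF ind1 SL ZN] Z(2)[OF N] by auto
    have sq: "integrable M (\<lambda>\<omega>. (?L \<omega>)\<^sup>2 * (Z N \<omega>)\<^sup>2)"
      "expectation (\<lambda>\<omega>. (?L \<omega>)\<^sup>2 * (Z N \<omega>)\<^sup>2) = expectation (\<lambda>\<omega>. (?L \<omega>)\<^sup>2) * expectation (\<lambda>\<omega>. (Z N \<omega>)\<^sup>2)"
      using indep_var_integrable[OF ind2 L(1) Z(1)[OF N]] indep_var_lebesgue_integral[OF ind2 L(1) Z(1)[OF N]] by auto
    \<comment> \<open>The zero diagonal is essential here: a square of \<open>Z N\<close> inside the
      form would become a fourth power after squaring.\<close>
    have split: "(?Q (insert N F) \<omega>)\<^sup>2 = (?S \<omega>)\<^sup>2 + 2 * (?S \<omega> * ?L \<omega> * Z N \<omega>) + (?L \<omega>)\<^sup>2 * (Z N \<omega>)\<^sup>2" for \<omega>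
    proof -
      have "?Q (insert N F) \<omega> = ?S \<omega> + ?L \<omega> * Z N \<omega>"
        using insert.hyps diag[of N]
        by (simp add: sum.distrib sum_distrib_left algebra_simps)
      then show ?thesis by (simp add: power2_eq_square algebra_simps)
    qed
    have "expectation (\<lambda>\<omega>. (?L \<omega>)\<^sup>2) * expectation (\<lambda>\<omega>. (Z N \<omega>)\<^sup>2) \<le> (4 * v * (\<Sum>a\<in>F. (A a N + A N a)\<^sup>2)) * v"
      by (rule mult_mono[OF L(2) v[OF N]]) (use \<open>0 \<le> v\<close> in \<open>simp_all add: sum_nonneg\<close>)
    also have "\<dots> = 4 * v\<^sup>2 * (\<Sum>a\<in>F. (A a N + A N a)\<^sup>2)"
      by (simp add: power2_eq_square)
    also have "\<dots> \<le> 4 * v\<^sup>2 * (\<Sum>a\<in>F. 2 * (A a N)\<^sup>2 + 2 * (A N a)\<^sup>2)"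
    proof (intro mult_left_mono sum_mono)
      show "(x + y)\<^sup>2 \<le> 2 * x\<^sup>2 + 2 * y\<^sup>2" for x y :: real
        using sum_squares_bound[of x y] by (simp add: power2_sum)
    qed auto
    also have "\<dots> = 8 * v\<^sup>2 * ((\<Sum>a\<in>F. (A a N)\<^sup>2) + (\<Sum>a\<in>F. (A N a)\<^sup>2))"
      unfolding sum.distrib by (simp add: algebra_simps flip: sum_distrib_left)
    finally have "expectation (\<lambda>\<omega>. (?S \<omega>)\<^sup>2 + 2 * (?S \<omega> * ?L \<omega> * Z N \<omega>) + (?L \<omega>)\<^sup>2 * (Z N \<omega>)\<^sup>2)
        \<le> 8 * v\<^sup>2 * (\<Sum>a\<in>F. \<Sum>b\<in>F. (A a b)\<^sup>2) + 8 * v\<^sup>2 * ((\<Sum>a\<in>F. (A a N)\<^sup>2) + (\<Sum>a\<in>F. (A N a)\<^sup>2))"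
      using S cross sq by simp
    moreover have "(\<Sum>a\<in>insert N F. \<Sum>b\<in>insert N F. (A a b)\<^sup>2)
        = (\<Sum>a\<in>F. \<Sum>b\<in>F. (A a b)\<^sup>2) + ((\<Sum>a\<in>F. (A a N)\<^sup>2) + (\<Sum>a\<in>F. (A N a)\<^sup>2))"
      using insert.hyps diag[of N] by (simp add: sum.distrib)
    ultimately show ?case
      using S(1) cross(1) sq(1) unfolding split by (simp add: algebra_simps)
  qed simp
  then show "integrable M (\<lambda>\<omega>. (?Q F \<omega>)\<^sup>2)"
    and "expectation (\<lambda>\<omega>. (?Q F \<omega>)\<^sup>2) \<le> 8 * v\<^sup>2 * (\<Sum>a\<in>F. \<Sum>b\<in>F. (A a b)\<^sup>2)"
    by auto
qed

end

section \<open>Power-law coefficients\<close>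

lemma sum_by_parts_nat:
  fixes a S :: "nat \<Rightarrow> real"
  assumes "S 0 = 0"
  shows "(\<Sum>j<N. a j * (S (Suc j) - S j)) = a N * S N + (\<Sum>j<N. (a j - a (Suc j)) * S (Suc j))"
  using assms by (induction N) (auto simp: algebra_simps)

text \<open>Abel summation: the boundary term is of order N powr (e - \<sigma>) and vanishes, while
  the differences of the weights gain one power and leave a series of order j powr (e - \<sigma> -
  1).\<close>

lemma summable_powr_mult_increments:
  fixes S :: "nat \<Rightarrow> real"
  assumes bound: "\<And>n. \<bar>S n\<bar> \<le> W * real n powr e" and e: "0 < e" "e < \<sigma>"
  shows "summable (\<lambda>j. (real j + 1) powr (- \<sigma>) * (S (Suc j) - S j))"
proof -
  define a where "a j = (real j + 1) powr (- \<sigma>)" for j :: nat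
  have S0: "S 0 = 0" using bound[of 0] e by simp
  have dec: "a (Suc j) \<le> a j" for j
    unfolding a_def using e by (intro powr_mono2') auto
  have "(\<lambda>N. a N * S N) \<longlonglongrightarrow> 0"
  proof (rule Lim_null_comparison)
    show "\<forall>\<^sub>F N in sequentially. norm (a N * S N) \<le> a N * (W * real N powr e)"
      using bound by (auto simp: abs_mult a_def intro!: always_eventually mult_left_mono)
    show "(\<lambda>N. a N * (W * real N powr e)) \<longlonglongrightarrow> 0"
    proof -
      have "(\<lambda>N. (real N + 1) powr (- \<sigma>) * real N powr e) \<longlonglongrightarrow> 0"
        using e by real_asymp
      from tendsto_mult_left[OF this, of W] show ?thesis
        by (simp add: a_def mult_ac)
    qed
  qed
  moreover have "summable (\<lambda>j. (a j - a (Suc j)) * S (Suc j))"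
  proof (rule summable_comparison_test)
    have "norm ((a j - a (Suc j)) * S (Suc j)) \<le> (a j - a (Suc j)) * (W * real (Suc j) powr e)" for j
      using bound[of "Suc j"] dec[of j] by (auto simp: abs_mult intro!: mult_left_mono)
    then show "\<exists>N. \<forall>j\<ge>N. norm ((a j - a (Suc j)) * S (Suc j)) \<le> W * ((a j - a (Suc j)) * real (Suc j) powr e)"
      by (simp add: mult_ac)
    have "summable (\<lambda>j. (a j - a (Suc j)) * real (Suc j) powr e)"
    proof (rule summable_comparison_test_bigo)
      show "summable (\<lambda>j. norm (real j powr (e - \<sigma> - 1)))"
        using e by (simp add: summable_real_powr_iff)
      have "(\<lambda>j. ((real j + 1) powr (- \<sigma>) - (real j + 2) powr (- \<sigma>)) * (real j + 1) powr e)
          \<in> O(\<lambda>j. real j powr (e - \<sigma> - 1))"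
        using e by real_asymp
      then show "(\<lambda>j. (a j - a (Suc j)) * real (Suc j) powr e) \<in> O(\<lambda>j. real j powr (e - \<sigma> - 1))"
        by (simp add: a_def add_ac)
    qed
    then show "summable (\<lambda>j. W * ((a j - a (Suc j)) * real (Suc j) powr e))"
      by (rule summable_mult)
  qed
  ultimately have "convergent (\<lambda>N. a N * S N + (\<Sum>j<N. (a j - a (Suc j)) * S (Suc j)))"
    by (intro convergent_add) (auto simp: convergent_def summable_iff_convergent)
  then show ?thesis
    unfolding summable_iff_convergent by (simp add: sum_by_parts_nat[of S, OF S0] flip: a_def)
qed

lemma summable_one_plus_powr:
  assumes "s < -1"
  shows "summable (\<lambda>i. (1 + real i) powr s)"
  using assms summable_Suc_iff[of "\<lambda>i. real i powr s"] by (simp add: summable_real_powr_iff)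

lemma sum_inj_le_suminf:
  fixes f :: "nat \<Rightarrow> real"
  assumes "summable f" "\<And>i. 0 \<le> f i" "finite A" "inj_on t A"
  shows "(\<Sum>a\<in>A. f (t a)) \<le> suminf f"
proof -
  have "(\<Sum>a\<in>A. f (t a)) = (\<Sum>i\<in>t ` A. f i)"
    using assms by (simp add: sum.reindex)
  also have "\<dots> \<le> suminf f"
    using assms by (intro sum_le_suminf) auto
  finally show ?thesis .
qed

text \<open>For u <= v let i = u - a and \<delta> = v - u. The larger lag's factor (1 + i +
  \<delta>) powr (- \<sigma>) is split: exponent - \<tau> is spent on the separation \<delta>, and
  \<tau> - \<sigma> on \<open>i\<close>. What remains is summable in \<open>i\<close> exactly when
  \<tau> < 2 * \<sigma> - 1. The choice \<tau> = 0 gives a bound uniform in the separation.\<close>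

lemma sum_shifted_products_le:
  fixes g :: "int \<Rightarrow> real"
  assumes g0: "\<And>l. l < 0 \<Longrightarrow> g l = 0"
    and gC: "\<And>l. \<bar>g l\<bar> \<le> C * (1 + \<bar>real_of_int l\<bar>) powr (- \<sigma>)" and "0 \<le> C"
    and \<tau>: "0 \<le> \<tau>" "\<tau> \<le> \<sigma>" "\<tau> < 2 * \<sigma> - 1" and "finite F"
  shows "(\<Sum>a\<in>F. \<bar>g (u - a)\<bar> * \<bar>g (v - a)\<bar>)
    \<le> C\<^sup>2 * (\<Sum>i. (1 + real i) powr (\<tau> - 2 * \<sigma>)) * (1 + \<bar>real_of_int (u - v)\<bar>) powr (- \<tau>)"
proof -
  have g0': "0 \<le> l" if "g l \<noteq> 0" for l
    using g0 that not_less by blast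
  have wlog: "(\<Sum>a\<in>F. \<bar>g (u - a)\<bar> * \<bar>g (v - a)\<bar>)
      \<le> C\<^sup>2 * (\<Sum>i. (1 + real i) powr (\<tau> - 2 * \<sigma>)) * (1 + \<bar>real_of_int (u - v)\<bar>) powr (- \<tau>)"
    if "u \<le> v" for u v
  proof -
    define \<delta> where "\<delta> = real_of_int (v - u)"
    have \<delta>: "\<delta> \<ge> 0" using that by (simp add: \<delta>_def)
    let ?f = "\<lambda>i::nat. (1 + real i) powr (\<tau> - 2 * \<sigma>)"
    have bnd: "\<bar>g (u - a)\<bar> * \<bar>g (v - a)\<bar> \<le> C\<^sup>2 * (1 + \<delta>) powr (- \<tau>) * ?f (nat (u - a))" if "a \<le> u" for a
    proof -
      define i where "i = real (nat (u - a))"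
      have i: "i \<ge> 0" "\<bar>real_of_int (u - a)\<bar> = i" "\<bar>real_of_int (v - a)\<bar> = i + \<delta>"
        using that \<delta> by (auto simp: i_def \<delta>_def)
      have "\<bar>g (u - a)\<bar> * \<bar>g (v - a)\<bar> \<le> (C * (1 + i) powr (- \<sigma>)) * (C * (1 + (i + \<delta>)) powr (- \<sigma>))"
        using gC[of "u - a"] gC[of "v - a"] \<open>0 \<le> C\<close> unfolding i by (intro mult_mono) auto
      also have "\<dots> = C\<^sup>2 * (1 + i) powr (- \<sigma>) * ((1 + (i + \<delta>)) powr (- \<tau>) * (1 + (i + \<delta>)) powr (\<tau> - \<sigma>))"
        by (simp add: power2_eq_square flip: powr_add)
      also have "\<dots> \<le> C\<^sup>2 * (1 + i) powr (- \<sigma>) * ((1 + \<delta>) powr (- \<tau>) * (1 + i) powr (\<tau> - \<sigma>))"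
        using i \<delta> \<tau> by (intro mult_left_mono mult_mono powr_mono2') auto
      also have "\<dots> = C\<^sup>2 * (1 + \<delta>) powr (- \<tau>) * ((1 + i) powr (- \<sigma>) * (1 + i) powr (\<tau> - \<sigma>))"
        by simp
      also have "(1 + i) powr (- \<sigma>) * (1 + i) powr (\<tau> - \<sigma>) = (1 + i) powr (\<tau> - 2 * \<sigma>)"
        by (simp flip: powr_add)
      finally show ?thesis by (simp add: i_def)
    qed
    have "(\<Sum>a\<in>F. \<bar>g (u - a)\<bar> * \<bar>g (v - a)\<bar>) = (\<Sum>a\<in>{a\<in>F. a \<le> u}. \<bar>g (u - a)\<bar> * \<bar>g (v - a)\<bar>)"
      using \<open>finite F\<close> by (intro sum.mono_neutral_right) (auto dest!: g0')
    also have "\<dots> \<le> (\<Sum>a\<in>{a\<in>F. a \<le> u}. C\<^sup>2 * (1 + \<delta>) powr (- \<tau>) * ?f (nat (u - a)))"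
      by (intro sum_mono bnd) auto
    also have "\<dots> = C\<^sup>2 * (1 + \<delta>) powr (- \<tau>) * (\<Sum>a\<in>{a\<in>F. a \<le> u}. ?f (nat (u - a)))"
      by (simp add: sum_distrib_left)
    also have "\<dots> \<le> C\<^sup>2 * (1 + \<delta>) powr (- \<tau>) * suminf ?f"
      using \<open>finite F\<close> \<tau>
      by (intro mult_left_mono sum_inj_le_suminf summable_one_plus_powr) (auto simp: inj_on_def)
    finally show ?thesis
      using that by (simp add: \<delta>_def mult_ac)
  qed
  show ?thesis
  proof (cases "u \<le> v")
    case False
    with wlog[of v u] show ?thesis by (simp add: mult.commute abs_minus_commute)
  qed (rule wlog)
qed

text \<open>The slack \<open>\<epsilon>\<close> turns the inner sum into a piece of a convergent series, which avoids comparison with an integral.\<close>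

lemma double_sum_powr_le:
  fixes m n :: nat
  assumes "0 \<le> \<theta>" "\<theta> \<le> 1" "0 < \<epsilon>"
  shows "(\<Sum>k\<in>{m..<m + n}. \<Sum>l\<in>{m..<m + n}. (1 + \<bar>real_of_int (int k - int l)\<bar>) powr (- \<theta>))
    \<le> 2 * (\<Sum>i. (1 + real i) powr (- 1 - \<epsilon>)) * real n powr (2 + \<epsilon> - \<theta>)"
proof -
  let ?I = "{m..<m + n}" and ?f = "\<lambda>i::nat. (1 + real i) powr (- 1 - \<epsilon>)"
  have inner: "(\<Sum>l\<in>?I. (1 + \<bar>real_of_int (int k - int l)\<bar>) powr (- \<theta>)) \<le> 2 * suminf ?f * real n powr (1 + \<epsilon> - \<theta>)"
    if "k \<in> ?I" for k
  proof -
    have "(1 + \<bar>real_of_int (int k - int l)\<bar>) powr (- \<theta>) \<le> real n powr (1 + \<epsilon> - \<theta>) * ?f (nat \<bar>int k - int l\<bar>)"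
      if "l \<in> ?I" for l
    proof -
      define d where "d = 1 + \<bar>real_of_int (int k - int l)\<bar>"
      have d: "1 \<le> d" "d \<le> real n" "1 + real (nat \<bar>int k - int l\<bar>) = d"
        using that \<open>k \<in> ?I\<close> by (auto simp: d_def)
      \<comment> \<open>Because \<theta> <= 1, the exponent 1 + \<epsilon> - \<theta> is positive,
        and d <= n bounds the first factor; the second is a term of the convergent series.\<close>
      have "d powr (- \<theta>) = d powr (1 + \<epsilon> - \<theta>) * d powr (- 1 - \<epsilon>)"
        by (simp flip: powr_add)
      also have "\<dots> \<le> real n powr (1 + \<epsilon> - \<theta>) * d powr (- 1 - \<epsilon>)"
        using d assms by (intro mult_right_mono powr_mono2) auto
      finally show ?thesis unfolding d(3) by (simp add: d_def)
    qed
    then have "(\<Sum>l\<in>?I. (1 + \<bar>real_of_int (int k - int l)\<bar>) powr (- \<theta>))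
        \<le> (\<Sum>l\<in>?I. real n powr (1 + \<epsilon> - \<theta>) * ?f (nat \<bar>int k - int l\<bar>))"
      by (rule sum_mono)
    also have "\<dots> = real n powr (1 + \<epsilon> - \<theta>) * (\<Sum>l\<in>?I. ?f (nat \<bar>int k - int l\<bar>))"
      by (simp add: sum_distrib_left)
    \<comment> \<open>On either side of \<open>k\<close> the distance to \<open>k\<close> is
      injective in \<open>l\<close>, so each side is bounded by the full series; this is the source
      of the factor 2.\<close>
    also have "(\<Sum>l\<in>?I. ?f (nat \<bar>int k - int l\<bar>))
        = (\<Sum>l\<in>{m..<k}. ?f (nat \<bar>int k - int l\<bar>)) + (\<Sum>l\<in>{k..<m + n}. ?f (nat \<bar>int k - int l\<bar>))"
      using that by (subst sum.atLeastLessThan_concat) auto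
    also have "real n powr (1 + \<epsilon> - \<theta>) * \<dots> \<le> real n powr (1 + \<epsilon> - \<theta>) * (suminf ?f + suminf ?f)"
      using assms
      by (intro mult_left_mono add_mono sum_inj_le_suminf summable_one_plus_powr) (auto simp: inj_on_def)
    finally show ?thesis by (simp add: algebra_simps)
  qed
  have "(\<Sum>k\<in>?I. \<Sum>l\<in>?I. (1 + \<bar>real_of_int (int k - int l)\<bar>) powr (- \<theta>))
      \<le> (\<Sum>k\<in>?I. 2 * suminf ?f * real n powr (1 + \<epsilon> - \<theta>))"
    by (rule sum_mono) (rule inner)
  also have "\<dots> = 2 * suminf ?f * (real n powr 1 * real n powr (1 + \<epsilon> - \<theta>))"
    by simp
  also have "\<dots> = 2 * suminf ?f * real n powr (2 + \<epsilon> - \<theta>)"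
    by (simp only: powr_add[symmetric]) (simp add: algebra_simps)
  finally show ?thesis .
qed

text \<open>The left side is the squared Hilbert-Schmidt norm of a sum of rank-one matrices.
  Expanding the square and exchanging sums turns it into the sum over \<open>k\<close>,
  \<open>l\<close> of products of the Gram entries of \<open>G\<close> and \<open>H\<close>.\<close>

lemma sum_square_bilinear_le:
  fixes G H :: "'k \<Rightarrow> 'i \<Rightarrow> real"
  assumes "\<And>k l. k \<in> I \<Longrightarrow> l \<in> I \<Longrightarrow> (\<Sum>a\<in>F. \<bar>G k a\<bar> * \<bar>G l a\<bar>) \<le> R k l"
    and "\<And>k l. k \<in> I \<Longrightarrow> l \<in> I \<Longrightarrow> (\<Sum>a\<in>F. \<bar>H k a\<bar> * \<bar>H l a\<bar>) \<le> R k l"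
  shows "(\<Sum>a\<in>F. \<Sum>b\<in>F. (\<Sum>k\<in>I. G k a * H k b)\<^sup>2) \<le> (\<Sum>k\<in>I. \<Sum>l\<in>I. (R k l)\<^sup>2)"
proof -
  have "(\<Sum>a\<in>F. \<Sum>b\<in>F. (\<Sum>k\<in>I. G k a * H k b)\<^sup>2)
      = (\<Sum>a\<in>F. \<Sum>b\<in>F. \<Sum>k\<in>I. \<Sum>l\<in>I. (G k a * G l a) * (H k b * H l b))"
    by (simp add: power2_eq_square sum_product mult_ac)
  also have "\<dots> = (\<Sum>a\<in>F. \<Sum>k\<in>I. \<Sum>b\<in>F. \<Sum>l\<in>I. (G k a * G l a) * (H k b * H l b))"
    by (intro sum.cong refl sum.swap)
  also have "\<dots> = (\<Sum>k\<in>I. \<Sum>a\<in>F. \<Sum>l\<in>I. \<Sum>b\<in>F. (G k a * G l a) * (H k b * H l b))"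
    by (subst sum.swap) (intro sum.cong refl sum.swap)
  also have "\<dots> = (\<Sum>k\<in>I. \<Sum>l\<in>I. \<Sum>a\<in>F. \<Sum>b\<in>F. (G k a * G l a) * (H k b * H l b))"
    by (intro sum.cong refl sum.swap)
  also have "\<dots> = (\<Sum>k\<in>I. \<Sum>l\<in>I. (\<Sum>a\<in>F. G k a * G l a) * (\<Sum>b\<in>F. H k b * H l b))"
    by (simp add: sum_product)
  also have "\<dots> \<le> (\<Sum>k\<in>I. \<Sum>l\<in>I. (R k l)\<^sup>2)"
  proof (intro sum_mono)
    fix k l assume kl: "k \<in> I" "l \<in> I"
    have G: "\<bar>\<Sum>a\<in>F. G k a * G l a\<bar> \<le> R k l"
      by (rule order_trans[OF sum_abs]) (use assms(1)[OF kl] in \<open>simp add: abs_mult\<close>)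
    have H: "\<bar>\<Sum>a\<in>F. H k a * H l a\<bar> \<le> R k l"
      by (rule order_trans[OF sum_abs]) (use assms(2)[OF kl] in \<open>simp add: abs_mult\<close>)
    have "\<bar>\<Sum>a\<in>F. G k a * G l a\<bar> * \<bar>\<Sum>b\<in>F. H k b * H l b\<bar> \<le> R k l * R k l"
      using G H by (intro mult_mono) auto
    then show "(\<Sum>a\<in>F. G k a * G l a) * (\<Sum>b\<in>F. H k b * H l b) \<le> (R k l)\<^sup>2"
      unfolding power2_eq_square abs_mult[symmetric] by linarith
  qed
  finally show ?thesis .
qed

text \<open>This gives the truncated off-diagonal part the shape of a quadratic form with zero
  diagonal.\<close>

lemma sum_off_diagonal:
  fixes p q z :: "'i \<Rightarrow> real"
  assumes "finite F"
  shows "(\<Sum>a\<in>F. \<Sum>b\<in>F. (if a = b then 0 else p a * q b) * z a * z b)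
    = (\<Sum>a\<in>F. p a * z a) * (\<Sum>b\<in>F. q b * z b) - (\<Sum>a\<in>F. p a * q a * (z a)\<^sup>2)"
proof -
  have "(\<Sum>b\<in>F. (if a = b then 0 else p a * q b) * z a * z b)
      = (\<Sum>b\<in>F. (p a * z a) * (q b * z b)) - p a * q a * (z a)\<^sup>2" if "a \<in> F" for a
  proof -
    have "(\<Sum>b\<in>F. (if a = b then 0 else p a * q b) * z a * z b)
        = (\<Sum>b\<in>F. (p a * z a) * (q b * z b) - (if a = b then p a * q a * (z a)\<^sup>2 else 0))"
      by (intro sum.cong) (auto simp: power2_eq_square)
    then show ?thesis
      using that assms by (simp add: sum_subtractf)
  qed
  then show ?thesis
    by (simp add: sum_product sum_subtractf)
qed

text \<open>Windows of noise indices, unlike partial sums in the lag \<open>j\<close>, do not move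
  with \<open>k\<close>; all times in a block can then be truncated to the same finite set of noise
  variables.\<close>

lemma window_sum_tendsto:
  fixes g :: "int \<Rightarrow> real"
  assumes g0: "\<And>a. a > k \<Longrightarrow> g a = 0" and sum: "summable (\<lambda>j. g (k - int j))"
  shows "(\<lambda>N. \<Sum>a\<in>{- int N..int N}. g a) \<longlonglongrightarrow> (\<Sum>j. g (k - int j))"
proof -
  \<comment> \<open>Once N >= |k|, the window effectively ends at \<open>k\<close>, and k - j
    running down to - N accounts for k + N + 1 lags.\<close>
  have "(\<Sum>a\<in>{- int N..int N}. g a) = (\<Sum>j<nat (k + int N + 1). g (k - int j))" if "N \<ge> nat \<bar>k\<bar>" for N
  proof -
    have "(\<Sum>a\<in>{- int N..int N}. g a) = (\<Sum>a\<in>{- int N..k}. g a)"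
      using that g0 by (intro sum.mono_neutral_right) auto
    also have "\<dots> = (\<Sum>j<nat (k + int N + 1). g (k - int j))"
      using that
      by (intro sum.reindex_bij_witness[of _ "\<lambda>j. k - int j" "\<lambda>a. nat (k - a)"]) auto
    finally show ?thesis .
  qed
  then have "\<forall>\<^sub>F N in sequentially. (\<Sum>j<nat (k + int N + 1). g (k - int j)) = (\<Sum>a\<in>{- int N..int N}. g a)"
    by (intro eventually_sequentiallyI[of "nat \<bar>k\<bar>"]) simp
  moreover have "(\<lambda>N. \<Sum>j<nat (k + int N + 1). g (k - int j)) \<longlonglongrightarrow> (\<Sum>j. g (k - int j))"
  proof (rule filterlim_compose[OF summable_LIMSEQ[OF sum]])
    have "\<forall>\<^sub>F N in sequentially. N - nat \<bar>k\<bar> \<le> nat (k + int N + 1)"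
      by (intro always_eventually) auto
    moreover have "filterlim (\<lambda>N. N - nat \<bar>k\<bar>) sequentially sequentially"
      by (rule filterlim_minus_const_nat_at_top)
    ultimately show "filterlim (\<lambda>N. nat (k + int N + 1)) sequentially sequentially"
      by (rule filterlim_at_top_mono[rotated])
  qed
  ultimately show ?thesis
    by (rule Lim_transform_eventually[rotated])
qed

section \<open>Linear processes\<close>

text \<open>Only second moments are fixed here; the finer moments of the squares enter as hypotheses
  of the diagonal bounds. The weight uses 1 + l because \<open>0 powr (- \<sigma>)\<close> is 0,
  which at l = 0 would force \<open>c 0\<close> to vanish.\<close>

locale linear_process = prob_space M for M :: "'a measure" +
  fixes \<xi> :: "int \<Rightarrow> 'a \<Rightarrow> real" and c :: "nat \<Rightarrow> real" and v C \<sigma> :: real and h :: nat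
  assumes indep: "indep_vars (\<lambda>_. borel) \<xi> UNIV"
    and mean_zero: "\<And>j. expectation (\<xi> j) = 0"
    and sq_integrable: "\<And>j. integrable M (\<lambda>\<omega>. (\<xi> j \<omega>)\<^sup>2)"
    and sq_mean: "\<And>j. expectation (\<lambda>\<omega>. (\<xi> j \<omega>)\<^sup>2) = v"
    and sigma: "1 / 2 < \<sigma>"
    and coeff: "\<And>l. \<bar>c l\<bar> \<le> C * (1 + real l) powr (- \<sigma>)"
begin

text \<open>Extension by zero turns the process into a convolution over all integers, indexed by the
  noise variable rather than by the lag.\<close>

definition coeff_int :: "int \<Rightarrow> real" where
  "coeff_int l = (if l < 0 then 0 else c (nat l))"

definition diag :: "int \<Rightarrow> 'a \<Rightarrow> real" where
  "diag k \<omega> = (\<Sum>j. c j * c (j + h) * ((\<xi> (k - int j) \<omega>)\<^sup>2 - v))"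

text \<open>Written as a product minus a single series, so that convergence of a double series is
  never at issue.\<close>

definition off_diag :: "int \<Rightarrow> 'a \<Rightarrow> real" where
  "off_diag k \<omega> = lin_proc c \<xi> k \<omega> * lin_proc c \<xi> (k + int h) \<omega>
    - (\<Sum>j. c j * c (j + h) * (\<xi> (k - int j) \<omega>)\<^sup>2)"

lemma measurable_noise [measurable]: "\<xi> j \<in> borel_measurable M"
  using indep by (simp add: indep_vars_def)

lemma measurable_diag [measurable]: "diag k \<in> borel_measurable M"
  unfolding diag_def by measurable

lemma measurable_off_diag [measurable]: "off_diag k \<in> borel_measurable M"
  unfolding off_diag_def lin_proc_def by measurable

lemma C_nonneg: "0 \<le> C"
  using coeff[of 0] by simp

lemma v_nonneg: "0 \<le> v"
  unfolding sq_mean[of 0, symmetric] by simp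

lemma coeff_int_le: "\<bar>coeff_int l\<bar> \<le> C * (1 + \<bar>real_of_int l\<bar>) powr (- \<sigma>)"
  using coeff[of "nat l"] C_nonneg by (auto simp: coeff_int_def)

lemma coeff_int_neg: "l < 0 \<Longrightarrow> coeff_int l = 0"
  by (simp add: coeff_int_def)

lemma coeff_int_shift [simp]: "coeff_int (k - (k - int j)) = c j" "coeff_int (k + int h - (k - int j)) = c (j + h)"
proof -
  have "nat (int h + int j) = j + h" by simp
  then show "coeff_int (k - (k - int j)) = c j" "coeff_int (k + int h - (k - int j)) = c (j + h)"
    by (simp_all add: coeff_int_def)
qed

text \<open>The products decay like j powr (- 2 * \<sigma>) with 2 * \<sigma> > 1, although the
  coefficients themselves need not be summable.\<close>

lemma summable_coeff_products: "summable (\<lambda>j. \<bar>c j * c (j + h)\<bar>)"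
proof (rule summable_comparison_test)
  have "\<bar>c j * c (j + h)\<bar> \<le> C\<^sup>2 * (1 + real j) powr (- 2 * \<sigma>)" for j
  proof -
    have "\<bar>c (j + h)\<bar> \<le> C * (1 + real j) powr (- \<sigma>)"
      by (rule order_trans[OF coeff]) (use C_nonneg sigma in \<open>auto intro!: mult_left_mono powr_mono2'\<close>)
    then have "\<bar>c j\<bar> * \<bar>c (j + h)\<bar> \<le> (C * (1 + real j) powr (- \<sigma>)) * (C * (1 + real j) powr (- \<sigma>))"
      using coeff[of j] C_nonneg by (intro mult_mono) auto
    also have "\<dots> = C\<^sup>2 * (1 + real j) powr (- 2 * \<sigma>)"
      by (simp add: power2_eq_square flip: powr_add)
    finally show ?thesis by (simp add: abs_mult)
  qed
  then show "\<exists>N. \<forall>j\<ge>N. norm \<bar>c j * c (j + h)\<bar> \<le> C\<^sup>2 * (1 + real j) powr (- 2 * \<sigma>)"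
    by simp
  show "summable (\<lambda>j. C\<^sup>2 * (1 + real j) powr (- 2 * \<sigma>))"
    using sigma by (intro summable_mult summable_one_plus_powr) simp
qed

text \<open>Chaining controls the partial sums with bounded weights \<open>(j + 1) powr \<sigma> * c j\<close>; summation by parts removes the factor \<open>(j + 1) powr \<sigma>\<close>.\<close>

lemma AE_summable_lin_proc: "AE \<omega> in M. \<forall>k. summable (\<lambda>j. c j * \<xi> (k - int j) \<omega>)"
  unfolding AE_all_countable
proof
  fix k :: int
  define w where "w j = (real j + 1) powr \<sigma> * c j" for j :: nat
  have w: "\<bar>w j\<bar> \<le> C" for j
  proof -
    have "\<bar>w j\<bar> \<le> (real j + 1) powr \<sigma> * (C * (1 + real j) powr (- \<sigma>))"
      unfolding w_def abs_mult using coeff[of j] by (intro mult_mono) auto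
    also have "\<dots> = C"
      by (simp add: powr_minus add.commute)
    finally show ?thesis .
  qed
  \<comment> \<open>The midpoint between 1/2 and \<sigma>: chaining with q = 2 and \<beta> = 1 asks
    for 2 * e > 1, summation by parts for e < \<sigma>.\<close>
  define e where "e = (\<sigma> + 1 / 2) / 2"
  have e: "1 < 2 * e" "0 < e" "e < \<sigma>"
    using sigma by (auto simp: e_def)
  have "AE \<omega> in M. (\<lambda>n. real n powr (- e) * (\<Sum>j<n. w j * \<xi> (k - int j) \<omega>)) \<longlonglongrightarrow> 0"
  proof (rule AE_normalised_partial_sums_tendsto_0[where q = 2 and \<beta> = 1 and K = "4 * v * C\<^sup>2"])
    fix m n :: nat
    let ?F = "(\<lambda>j. k - int j) ` {m..<m + n}"
    have inj: "inj_on (\<lambda>j. k - int j) A" for A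
      by (auto simp: inj_on_def)
    have "(\<Sum>j\<in>{m..<m + n}. w j * \<xi> (k - int j) \<omega>) = (\<Sum>a\<in>?F. w (nat (k - a)) * \<xi> a \<omega>)" for \<omega>
      by (simp add: sum.reindex[OF inj])
    then have "(\<integral>\<^sup>+\<omega>. ennreal (\<bar>\<Sum>j\<in>{m..<m + n}. w j * \<xi> (k - int j) \<omega>\<bar> powr 2) \<partial>M)
        = (\<integral>\<^sup>+\<omega>. ennreal (\<bar>\<Sum>a\<in>?F. w (nat (k - a)) * \<xi> a \<omega>\<bar> powr 2) \<partial>M)"
      by simp
    also have "\<dots> \<le> ennreal (2 * 2 * v * (\<Sum>a\<in>?F. \<bar>w (nat (k - a))\<bar> powr 2))"
      using indep mean_zero sq_integrable sq_mean by (intro von_Bahr_Esseen_nn_integral[where I = UNIV]) auto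
    also have "\<dots> \<le> ennreal (2 * 2 * v * (\<Sum>a\<in>?F. C\<^sup>2))"
      using w v_nonneg by (intro ennreal_leI mult_left_mono sum_mono) (auto simp: abs_le_square_iff[symmetric] intro: order_trans[OF _ abs_ge_self])
    also have "\<dots> = ennreal (4 * v * C\<^sup>2 * real n powr 1)"
      by (simp add: card_image[OF inj] mult_ac)
    finally show "(\<integral>\<^sup>+\<omega>. ennreal (\<bar>\<Sum>j\<in>{m..<m + n}. w j * \<xi> (k - int j) \<omega>\<bar> powr 2) \<partial>M)
        \<le> ennreal (4 * v * C\<^sup>2 * real n powr 1)" .
  qed (use e v_nonneg in auto)
  then show "AE \<omega> in M. summable (\<lambda>j. c j * \<xi> (k - int j) \<omega>)"
  proof eventually_elim
    case (elim \<omega>)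
    define S where "S n = (\<Sum>j<n. w j * \<xi> (k - int j) \<omega>)" for n
    from elim have "Bseq (\<lambda>n. real n powr (- e) * S n)"
      unfolding S_def by (intro convergent_imp_Bseq convergentI)
    then obtain W where W: "\<And>n. \<bar>real n powr (- e) * S n\<bar> \<le> W"
      by (auto simp: Bseq_def)
    have "\<bar>S n\<bar> \<le> W * real n powr e" for n
    proof (cases "n = 0")
      case False
      then show ?thesis
        using W[of n] by (simp add: abs_mult powr_minus field_simps)
    qed (simp add: S_def)
    then have "summable (\<lambda>j. (real j + 1) powr (- \<sigma>) * (S (Suc j) - S j))"
      using e(2,3) by (rule summable_powr_mult_increments)
    moreover have "(real j + 1) powr (- \<sigma>) * (S (Suc j) - S j) = c j * \<xi> (k - int j) \<omega>" for j
      by (simp add: S_def w_def powr_minus)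
    ultimately show ?case by simp
  qed
qed

lemma AE_summable_squares: "AE \<omega> in M. \<forall>k. summable (\<lambda>j. c j * c (j + h) * (\<xi> (k - int j) \<omega>)\<^sup>2)"
  unfolding AE_all_countable
proof
  fix k :: int
  let ?f = "\<lambda>j \<omega>. \<bar>c j * c (j + h)\<bar> * (\<xi> (k - int j) \<omega>)\<^sup>2"
  have "(\<integral>\<^sup>+\<omega>. ennreal (?f j \<omega>) \<partial>M) = ennreal (\<bar>c j * c (j + h)\<bar> * v)" for j
    using sq_integrable[of "k - int j"] by (subst nn_integral_eq_integral) (auto simp: sq_mean)
  then have "(\<integral>\<^sup>+\<omega>. (\<Sum>j. ennreal (?f j \<omega>)) \<partial>M) = (\<Sum>j. ennreal (\<bar>c j * c (j + h)\<bar> * v))"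
    by (subst nn_integral_suminf) auto
  also have "\<dots> < \<infinity>"
    using v_nonneg summable_coeff_products
    by (subst suminf_ennreal2) (auto intro: summable_mult2)
  finally have "AE \<omega> in M. (\<Sum>j. ennreal (?f j \<omega>)) \<noteq> \<infinity>"
    by (intro nn_integral_PInf_AE) auto
  then show "AE \<omega> in M. summable (\<lambda>j. c j * c (j + h) * (\<xi> (k - int j) \<omega>)\<^sup>2)"
  proof eventually_elim
    case (elim \<omega>)
    then have "summable (\<lambda>j. ?f j \<omega>)"
      by (intro summable_suminf_not_top) auto
    then show ?case
      by (intro summable_norm_cancel[of "\<lambda>j. c j * c (j + h) * (\<xi> (k - int j) \<omega>)\<^sup>2"]) (simp add: abs_mult)
  qed
qed

section \<open>Decomposition of the centred products and block moment bounds\<close>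

lemma diag_eq:
  assumes "summable (\<lambda>j. c j * c (j + h) * (\<xi> (k - int j) \<omega>)\<^sup>2)"
  shows "summable (\<lambda>j. c j * c (j + h) * ((\<xi> (k - int j) \<omega>)\<^sup>2 - v))"
    and "diag k \<omega> = (\<Sum>j. c j * c (j + h) * (\<xi> (k - int j) \<omega>)\<^sup>2) - v * (\<Sum>j. c j * c (j + h))"
proof -
  have s: "summable (\<lambda>j. c j * c (j + h))"
    using summable_coeff_products by (rule summable_rabs_cancel)
  have eq: "c j * c (j + h) * ((\<xi> (k - int j) \<omega>)\<^sup>2 - v)
      = c j * c (j + h) * (\<xi> (k - int j) \<omega>)\<^sup>2 - c j * c (j + h) * v" for j
    by (simp add: algebra_simps)
  show "summable (\<lambda>j. c j * c (j + h) * ((\<xi> (k - int j) \<omega>)\<^sup>2 - v))"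
    unfolding eq by (intro summable_diff assms summable_mult2 s)
  show "diag k \<omega> = (\<Sum>j. c j * c (j + h) * (\<xi> (k - int j) \<omega>)\<^sup>2) - v * (\<Sum>j. c j * c (j + h))"
    unfolding diag_def eq using suminf_diff[OF assms summable_mult2[OF s, of v]] suminf_mult2[OF s, of v]
    by (simp add: mult.commute)
qed

text \<open>The series of squares cancels between the two parts; centring it termwise is legitimate
  only where it converges, hence the exceptional null set.\<close>

lemma AE_decomposition:
  "AE \<omega> in M. \<forall>k. lin_proc c \<xi> k \<omega> * lin_proc c \<xi> (k + int h) \<omega> - v * (\<Sum>j. c j * c (j + h))
    = off_diag k \<omega> + diag k \<omega>"
  using AE_summable_squares by eventually_elim (simp add: off_diag_def diag_eq(2))

text \<open>After exchanging sums a block is a weighted sum of centred squares. Summing the kernel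
  over time gives weights of size at most \<open>R\<close>, summing it over the noise gives total
  weight at most n * R, so the q-th powers of the weights add up to at most R powr q * n. The von
  Bahr-Esseen bound then makes the moment linear in \<open>n\<close>.\<close>

lemma diag_moment_le:
  assumes q: "1 < q" "q \<le> 2"
    and Z: "\<And>a. integrable M (\<lambda>\<omega>. \<bar>(\<xi> a \<omega>)\<^sup>2 - v\<bar> powr q)"
    and K: "\<And>a. expectation (\<lambda>\<omega>. \<bar>(\<xi> a \<omega>)\<^sup>2 - v\<bar> powr q) \<le> K"
  shows "\<exists>K'\<ge>0. \<forall>m n. (\<integral>\<^sup>+\<omega>. ennreal (\<bar>\<Sum>i\<in>{m..<m + n}. diag (int i + 1) \<omega>\<bar> powr q) \<partial>M)
    \<le> ennreal (K' * real n powr 1)"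
proof -
  let ?g = coeff_int
  \<comment> \<open>This is the bound for shifted products at \<tau> = 0; the last factor equals 1
    and only keeps the shape of that instance.\<close>
  define R where "R = C\<^sup>2 * (\<Sum>i. (1 + real i) powr (0 - 2 * \<sigma>)) * (1 + \<bar>real_of_int (int h)\<bar>) powr (- 0)"
  have row: "(\<Sum>a\<in>F. \<bar>?g (k - a) * ?g (k + int h - a)\<bar>) \<le> R" if "finite F" for F k
    using sum_shifted_products_le[of ?g C \<sigma> 0 F k "k + int h"] that sigma C_nonneg coeff_int_neg coeff_int_le
    by (simp add: R_def abs_mult)
  \<comment> \<open>The kernel depends only on the difference of time and noise index, so reflecting
    the times turns a sum over time into one over the noise.\<close>
  have col: "(\<Sum>i\<in>J. \<bar>?g (int i + 1 - a) * ?g (int i + 1 + int h - a)\<bar>) \<le> R" if "finite J" for J a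
  proof -
    have inj: "inj_on (\<lambda>i. - int i) J" by (auto simp: inj_on_def)
    have "(\<Sum>b\<in>(\<lambda>i. - int i) ` J. \<bar>?g ((1 - a) - b) * ?g ((1 - a) + int h - b)\<bar>) \<le> R"
      using that by (intro row) auto
    then show ?thesis
      unfolding sum.reindex[OF inj] by (simp add: algebra_simps)
  qed
  have R: "0 \<le> R" using row[of "{}"] by simp
  have K_nonneg: "0 \<le> K" by (rule order_trans[OF _ K[of 0]]) simp
  have ind: "indep_vars (\<lambda>_. borel) (\<lambda>a \<omega>. (\<xi> a \<omega>)\<^sup>2 - v) UNIV"
    using indep by (rule indep_vars_compose2) measurable
  have mean: "expectation (\<lambda>\<omega>. (\<xi> a \<omega>)\<^sup>2 - v) = 0" for a
    using sq_integrable[of a] by (simp add: sq_mean prob_space)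
  have "(\<integral>\<^sup>+\<omega>. ennreal (\<bar>\<Sum>i\<in>{m..<m + n}. diag (int i + 1) \<omega>\<bar> powr q) \<partial>M)
      \<le> ennreal (2 * q * K * R powr q * real n powr 1)" for m n
  proof (rule nn_integral_powr_le_of_tendsto)
    let ?F = "\<lambda>N. {- int N..int N}" and ?J = "{m..<m + n}"
    let ?W = "\<lambda>N \<omega>. \<Sum>i\<in>?J. \<Sum>a\<in>?F N. ?g (int i + 1 - a) * ?g (int i + 1 + int h - a) * ((\<xi> a \<omega>)\<^sup>2 - v)"
    show "?W N \<in> borel_measurable M" for N
      by measurable
    show "AE \<omega> in M. (\<lambda>N. ?W N \<omega>) \<longlonglongrightarrow> (\<Sum>i\<in>?J. diag (int i + 1) \<omega>)"
      using AE_summable_squares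
    proof eventually_elim
      case (elim \<omega>)
      show ?case
      proof (rule tendsto_sum)
        fix i
        have s: "summable (\<lambda>j. c j * c (j + h) * ((\<xi> (int i + 1 - int j) \<omega>)\<^sup>2 - v))"
          using elim by (intro diag_eq(1)) blast
        show "(\<lambda>N. \<Sum>a\<in>?F N. ?g (int i + 1 - a) * ?g (int i + 1 + int h - a) * ((\<xi> a \<omega>)\<^sup>2 - v))
            \<longlonglongrightarrow> diag (int i + 1) \<omega>"
          using window_sum_tendsto[of "int i + 1"
            "\<lambda>a. ?g (int i + 1 - a) * ?g (int i + 1 + int h - a) * ((\<xi> a \<omega>)\<^sup>2 - v)"] s
          unfolding coeff_int_shift diag_def by (simp add: coeff_int_neg)
      qed
    qed
    fix N
    define w where "w a = (\<Sum>i\<in>?J. ?g (int i + 1 - a) * ?g (int i + 1 + int h - a))" for a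
    have w: "\<bar>w a\<bar> \<le> R" for a
      unfolding w_def by (rule order_trans[OF sum_abs col]) simp
    have "(\<Sum>a\<in>?F N. \<bar>w a\<bar>) \<le> (\<Sum>a\<in>?F N. \<Sum>i\<in>?J. \<bar>?g (int i + 1 - a) * ?g (int i + 1 + int h - a)\<bar>)"
      unfolding w_def by (intro sum_mono sum_abs)
    also have "\<dots> = (\<Sum>i\<in>?J. \<Sum>a\<in>?F N. \<bar>?g (int i + 1 - a) * ?g (int i + 1 + int h - a)\<bar>)"
      by (rule sum.swap)
    also have "\<dots> \<le> (\<Sum>i\<in>?J. R)"
      by (intro sum_mono row) simp
    finally have sum_w: "(\<Sum>a\<in>?F N. \<bar>w a\<bar>) \<le> real n * R"
      by simp
    have "(\<Sum>a\<in>?F N. \<bar>w a\<bar> powr q) \<le> (\<Sum>a\<in>?F N. R powr (q - 1) * \<bar>w a\<bar>)"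
    proof (rule sum_mono)
      fix a
      have "\<bar>w a\<bar> powr q = \<bar>w a\<bar> powr (q - 1) * \<bar>w a\<bar>"
        using powr_add[of "\<bar>w a\<bar>" "q - 1" 1] by simp
      also have "\<dots> \<le> R powr (q - 1) * \<bar>w a\<bar>"
        using w[of a] q by (intro mult_right_mono powr_mono2) auto
      finally show "\<bar>w a\<bar> powr q \<le> R powr (q - 1) * \<bar>w a\<bar>" .
    qed
    also have "\<dots> \<le> R powr (q - 1) * (real n * R)"
      unfolding sum_distrib_left[symmetric] by (intro mult_left_mono sum_w) simp
    also have "\<dots> = R powr q * real n"
      using R powr_add[of R "q - 1" 1] by simp
    finally have wq: "(\<Sum>a\<in>?F N. \<bar>w a\<bar> powr q) \<le> R powr q * real n" .
    have "?W N \<omega> = (\<Sum>a\<in>?F N. w a * ((\<xi> a \<omega>)\<^sup>2 - v))" for \<omega>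
      unfolding w_def sum_distrib_right by (rule sum.swap)
    then have "(\<integral>\<^sup>+\<omega>. ennreal (\<bar>?W N \<omega>\<bar> powr q) \<partial>M)
        = (\<integral>\<^sup>+\<omega>. ennreal (\<bar>\<Sum>a\<in>?F N. w a * ((\<xi> a \<omega>)\<^sup>2 - v)\<bar> powr q) \<partial>M)"
      by simp
    also have "\<dots> \<le> ennreal (2 * q * K * (\<Sum>a\<in>?F N. \<bar>w a\<bar> powr q))"
      using Z K mean by (intro von_Bahr_Esseen_nn_integral[OF q _ _ ind]) auto
    also have "\<dots> \<le> ennreal (2 * q * K * (R powr q * real n))"
      using q K_nonneg by (intro ennreal_leI mult_left_mono wq) auto
    finally show "(\<integral>\<^sup>+\<omega>. ennreal (\<bar>?W N \<omega>\<bar> powr q) \<partial>M) \<le> ennreal (2 * q * K * R powr q * real n powr 1)"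
      by (simp add: mult.assoc)
  qed (use q in simp)
  moreover have "0 \<le> 2 * q * K * R powr q"
    using q K_nonneg by simp
  ultimately show ?thesis by blast
qed

text \<open>The second moment is controlled by the sum of squared matrix entries, hence by squared
  Gram entries of order |k - l| powr (- 2 * \<tau>). Their double sum over the block has exponent 2
  + \<epsilon> - 2 * \<tau>; the condition \<tau> <= 1/2 makes 2 * \<tau> <= 1, as that double sum
  requires.\<close>

lemma off_diag_moment_le:
  assumes \<tau>: "0 \<le> \<tau>" "\<tau> \<le> 1 / 2" "\<tau> < 2 * \<sigma> - 1" and \<epsilon>: "0 < \<epsilon>"
  shows "\<exists>K'\<ge>0. \<forall>m n. (\<integral>\<^sup>+\<omega>. ennreal (\<bar>\<Sum>i\<in>{m..<m + n}. off_diag (int i + 1) \<omega>\<bar> powr 2) \<partial>M)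
    \<le> ennreal (K' * real n powr (2 + \<epsilon> - 2 * \<tau>))"
proof -
  let ?g = coeff_int
  define R where "R = C\<^sup>2 * (\<Sum>i. (1 + real i) powr (\<tau> - 2 * \<sigma>))"
  define Z where "Z = (\<Sum>i. (1 + real i) powr (- 1 - \<epsilon>))"
  define r where "r k l = R * (1 + \<bar>real_of_int (int k - int l)\<bar>) powr (- \<tau>)" for k l :: nat
  have Z: "0 \<le> Z"
    unfolding Z_def using \<epsilon> by (intro suminf_nonneg summable_one_plus_powr) auto
  \<comment> \<open>The common offset \<open>x\<close> cancels in the difference of times, so the
    same bound serves both factors of the product, with \<open>x\<close> equal to 1 and to 1 +
    h.\<close>
  have row: "(\<Sum>a\<in>F. \<bar>?g (x + int k - a)\<bar> * \<bar>?g (x + int l - a)\<bar>) \<le> r k l" if "finite F" for F k l x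
    using sum_shifted_products_le[of ?g C \<sigma> \<tau> F "x + int k" "x + int l"] that \<tau> sigma C_nonneg coeff_int_neg coeff_int_le
    by (simp add: R_def r_def)
  have "(\<integral>\<^sup>+\<omega>. ennreal (\<bar>\<Sum>i\<in>{m..<m + n}. off_diag (int i + 1) \<omega>\<bar> powr 2) \<partial>M)
      \<le> ennreal (16 * v\<^sup>2 * R\<^sup>2 * Z * real n powr (2 + \<epsilon> - 2 * \<tau>))" for m n
  proof (rule nn_integral_powr_le_of_tendsto)
    let ?F = "\<lambda>N. {- int N..int N}" and ?J = "{m..<m + n}"
    define p where "p i a = ?g (int i + 1 - a)" for i :: nat and a
    define p' where "p' i a = ?g (int i + 1 + int h - a)" for i :: nat and a
    let ?W = "\<lambda>N \<omega>. \<Sum>i\<in>?J. (\<Sum>a\<in>?F N. p i a * \<xi> a \<omega>) * (\<Sum>b\<in>?F N. p' i b * \<xi> b \<omega>)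
      - (\<Sum>a\<in>?F N. p i a * p' i a * (\<xi> a \<omega>)\<^sup>2)"
    show "?W N \<in> borel_measurable M" for N
      by measurable
    show "AE \<omega> in M. (\<lambda>N. ?W N \<omega>) \<longlonglongrightarrow> (\<Sum>i\<in>?J. off_diag (int i + 1) \<omega>)"
      using AE_summable_squares AE_summable_lin_proc
    proof eventually_elim
      case (elim \<omega>)
      show ?case
        unfolding off_diag_def
      proof (intro tendsto_sum tendsto_diff tendsto_mult)
        fix i
        have lin: "(\<lambda>N. \<Sum>a\<in>?F N. ?g (k - a) * \<xi> a \<omega>) \<longlonglongrightarrow> lin_proc c \<xi> k \<omega>" for k
          using window_sum_tendsto[of k "\<lambda>a. ?g (k - a) * \<xi> a \<omega>"] elim(2)
          unfolding coeff_int_shift lin_proc_def by (simp add: coeff_int_neg)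
        show "(\<lambda>N. \<Sum>a\<in>?F N. p i a * \<xi> a \<omega>) \<longlonglongrightarrow> lin_proc c \<xi> (int i + 1) \<omega>"
          "(\<lambda>N. \<Sum>a\<in>?F N. p' i a * \<xi> a \<omega>) \<longlonglongrightarrow> lin_proc c \<xi> (int i + 1 + int h) \<omega>"
          unfolding p_def p'_def by (rule lin)+
        show "(\<lambda>N. \<Sum>a\<in>?F N. p i a * p' i a * (\<xi> a \<omega>)\<^sup>2)
            \<longlonglongrightarrow> (\<Sum>j. c j * c (j + h) * (\<xi> (int i + 1 - int j) \<omega>)\<^sup>2)"
          using window_sum_tendsto[of "int i + 1" "\<lambda>a. ?g (int i + 1 - a) * ?g (int i + 1 + int h - a) * (\<xi> a \<omega>)\<^sup>2"] elim(1)
          unfolding coeff_int_shift p_def p'_def by (simp add: coeff_int_neg)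
      qed
    qed
    fix N
    define A where "A a b = (if a = b then 0 else \<Sum>i\<in>?J. p i a * p' i b)" for a b
    have W: "?W N \<omega> = (\<Sum>a\<in>?F N. \<Sum>b\<in>?F N. A a b * \<xi> a \<omega> * \<xi> b \<omega>)" for \<omega>
    proof -
      have "?W N \<omega> = (\<Sum>i\<in>?J. \<Sum>a\<in>?F N. \<Sum>b\<in>?F N. (if a = b then 0 else p i a * p' i b) * \<xi> a \<omega> * \<xi> b \<omega>)"
        by (simp only: sum_off_diagonal finite_atLeastAtMost_int)
      also have "\<dots> = (\<Sum>a\<in>?F N. \<Sum>i\<in>?J. \<Sum>b\<in>?F N. (if a = b then 0 else p i a * p' i b) * \<xi> a \<omega> * \<xi> b \<omega>)"
        by (rule sum.swap)
      also have "\<dots> = (\<Sum>a\<in>?F N. \<Sum>b\<in>?F N. \<Sum>i\<in>?J. (if a = b then 0 else p i a * p' i b) * \<xi> a \<omega> * \<xi> b \<omega>)"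
        by (intro sum.cong refl sum.swap)
      also have "\<dots> = (\<Sum>a\<in>?F N. \<Sum>b\<in>?F N. A a b * \<xi> a \<omega> * \<xi> b \<omega>)"
        by (intro sum.cong refl) (simp add: A_def sum_distrib_right)
      finally show ?thesis .
    qed
    \<comment> \<open>Restoring the diagonal entries only adds squares, and it yields the full sum
      of rank-one matrices to which the Gram bound applies.\<close>
    have "(\<Sum>a\<in>?F N. \<Sum>b\<in>?F N. (A a b)\<^sup>2) \<le> (\<Sum>a\<in>?F N. \<Sum>b\<in>?F N. (\<Sum>i\<in>?J. p i a * p' i b)\<^sup>2)"
      by (intro sum_mono) (simp add: A_def)
    also have "\<dots> \<le> (\<Sum>k\<in>?J. \<Sum>l\<in>?J. (r k l)\<^sup>2)"
    proof (rule sum_square_bilinear_le)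
      fix k l
      show "(\<Sum>a\<in>?F N. \<bar>p k a\<bar> * \<bar>p l a\<bar>) \<le> r k l"
        using row[of "?F N" 1 k l] by (simp add: p_def add_ac)
      show "(\<Sum>a\<in>?F N. \<bar>p' k a\<bar> * \<bar>p' l a\<bar>) \<le> r k l"
        using row[of "?F N" "1 + int h" k l] by (simp add: p'_def add_ac)
    qed
    also have "\<dots> = R\<^sup>2 * (\<Sum>k\<in>?J. \<Sum>l\<in>?J. (1 + \<bar>real_of_int (int k - int l)\<bar>) powr (- (2 * \<tau>)))"
      unfolding sum_distrib_left r_def power_mult_distrib
      by (intro sum.cong refl arg_cong2[where f = "(*)"]) (simp add: power2_eq_square flip: powr_add)
    also have "\<dots> \<le> R\<^sup>2 * (2 * Z * real n powr (2 + \<epsilon> - 2 * \<tau>))"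
      unfolding Z_def using \<tau> \<epsilon> by (intro mult_left_mono double_sum_powr_le) auto
    finally have A: "(\<Sum>a\<in>?F N. \<Sum>b\<in>?F N. (A a b)\<^sup>2) \<le> R\<^sup>2 * (2 * Z * real n powr (2 + \<epsilon> - 2 * \<tau>))" .
    have E: "integrable M (\<lambda>\<omega>. (\<Sum>a\<in>?F N. \<Sum>b\<in>?F N. A a b * \<xi> a \<omega> * \<xi> b \<omega>)\<^sup>2)"
      "expectation (\<lambda>\<omega>. (\<Sum>a\<in>?F N. \<Sum>b\<in>?F N. A a b * \<xi> a \<omega> * \<xi> b \<omega>)\<^sup>2)
        \<le> 8 * v\<^sup>2 * (\<Sum>a\<in>?F N. \<Sum>b\<in>?F N. (A a b)\<^sup>2)"
      using expectation_quadratic_form_square_le[of "?F N" UNIV \<xi> v A] indep mean_zero sq_integrable sq_mean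
      by (auto simp: A_def)
    have "(\<integral>\<^sup>+\<omega>. ennreal (\<bar>?W N \<omega>\<bar> powr 2) \<partial>M)
        = ennreal (expectation (\<lambda>\<omega>. (\<Sum>a\<in>?F N. \<Sum>b\<in>?F N. A a b * \<xi> a \<omega> * \<xi> b \<omega>)\<^sup>2))"
      unfolding W using E(1) by (subst nn_integral_eq_integral[symmetric]) auto
    also have "\<dots> \<le> ennreal (8 * v\<^sup>2 * (R\<^sup>2 * (2 * Z * real n powr (2 + \<epsilon> - 2 * \<tau>))))"
      by (intro ennreal_leI order_trans[OF E(2)] mult_left_mono A) simp
    also have "8 * v\<^sup>2 * (R\<^sup>2 * (2 * Z * real n powr (2 + \<epsilon> - 2 * \<tau>))) = 16 * v\<^sup>2 * R\<^sup>2 * Z * real n powr (2 + \<epsilon> - 2 * \<tau>)"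
      by simp
    finally show "(\<integral>\<^sup>+\<omega>. ennreal (\<bar>?W N \<omega>\<bar> powr 2) \<partial>M)
        \<le> ennreal (16 * v\<^sup>2 * R\<^sup>2 * Z * real n powr (2 + \<epsilon> - 2 * \<tau>))" .
  qed simp
  moreover have "0 \<le> 16 * v\<^sup>2 * R\<^sup>2 * Z"
    using Z by simp
  ultimately show ?thesis by blast
qed

section \<open>Rates for the sample autocovariance and the choice of exponents\<close>

lemma sample_autocov_eq:
  "real n * (sample_autocov (lin_proc c \<xi>) h n \<omega> - \<gamma>)
    = (\<Sum>i<n. lin_proc c \<xi> (int i + 1) \<omega> * lin_proc c \<xi> (int i + 1 + int h) \<omega> - \<gamma>)"
proof -
  have "(\<Sum>k\<in>{1..int n}. lin_proc c \<xi> k \<omega> * lin_proc c \<xi> (k + int h) \<omega>)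
      = (\<Sum>i<n. lin_proc c \<xi> (int i + 1) \<omega> * lin_proc c \<xi> (int i + 1 + int h) \<omega>)"
    by (rule sum.reindex_bij_witness[of _ "\<lambda>i. int i + 1" "\<lambda>k. nat (k - 1)"]) auto
  then show ?thesis
    by (simp add: sample_autocov_def sum_subtractf right_diff_distrib)
qed

text \<open>The exponent \<open>e\<close> stands in for 1 / p. The conditions e > 1/2 and e > 2 - 2
  * \<sigma> leave room for some \<tau> between 1 - e and min (1/2) (2 * \<sigma> - 1), which serves
  the off-diagonal part; 1 < q * e serves the diagonal one.\<close>

lemma AE_autocov_convergence:
  assumes q: "1 < q" "q \<le> 2" "1 < q * e"
    and Z: "\<And>a. integrable M (\<lambda>\<omega>. \<bar>(\<xi> a \<omega>)\<^sup>2 - v\<bar> powr q)"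
    and K: "\<And>a. expectation (\<lambda>\<omega>. \<bar>(\<xi> a \<omega>)\<^sup>2 - v\<bar> powr q) \<le> K"
    and e: "1 / 2 < e" "e < 1" "2 - 2 * \<sigma> < e"
  shows "AE \<omega> in M. (\<lambda>n. real n powr (1 - e) *
      (sample_autocov (lin_proc c \<xi>) h n \<omega> - v * (\<Sum>j. c j * c (j + h)))) \<longlonglongrightarrow> 0"
proof -
  let ?\<gamma> = "v * (\<Sum>j. c j * c (j + h))"
  have "1 - e < min (1 / 2) (2 * \<sigma> - 1)"
    using e by simp
  then obtain \<tau> where \<tau>: "1 - e < \<tau>" "\<tau> < 1 / 2" "\<tau> < 2 * \<sigma> - 1"
    using dense by (metis min_less_iff_conj)
  \<comment> \<open>With this slack the variance exponent becomes 1 + e - \<tau>: it is below 2 * e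
    because \<tau> > 1 - e, and at least 1 because \<tau> < 1/2 < e, the two conditions for
    chaining.\<close>
  define \<epsilon> where "\<epsilon> = e - 1 + \<tau>"
  have \<epsilon>: "0 < \<epsilon>" "1 \<le> 2 + \<epsilon> - 2 * \<tau>" "2 + \<epsilon> - 2 * \<tau> < 2 * e"
    using \<tau> e by (auto simp: \<epsilon>_def)
  obtain K1 where K1: "K1 \<ge> 0"
    "\<And>m n. (\<integral>\<^sup>+\<omega>. ennreal (\<bar>\<Sum>i\<in>{m..<m + n}. off_diag (int i + 1) \<omega>\<bar> powr 2) \<partial>M)
      \<le> ennreal (K1 * real n powr (2 + \<epsilon> - 2 * \<tau>))"
    using off_diag_moment_le[of \<tau> \<epsilon>] \<tau> \<epsilon> e by auto
  obtain K2 where K2: "K2 \<ge> 0"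
    "\<And>m n. (\<integral>\<^sup>+\<omega>. ennreal (\<bar>\<Sum>i\<in>{m..<m + n}. diag (int i + 1) \<omega>\<bar> powr q) \<partial>M)
      \<le> ennreal (K2 * real n powr 1)"
    using diag_moment_le[OF q(1,2) Z K] by blast
  have "AE \<omega> in M. (\<lambda>n. real n powr (- e) * (\<Sum>i<n. off_diag (int i + 1) \<omega>)) \<longlonglongrightarrow> 0"
    by (rule AE_normalised_partial_sums_tendsto_0[OF _ K1(2)]) (use K1 \<epsilon> in auto)
  moreover have "AE \<omega> in M. (\<lambda>n. real n powr (- e) * (\<Sum>i<n. diag (int i + 1) \<omega>)) \<longlonglongrightarrow> 0"
    by (rule AE_normalised_partial_sums_tendsto_0[OF _ K2(2)]) (use K2 q in auto)
  ultimately show ?thesis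
    using AE_decomposition
  proof eventually_elim
    case (elim \<omega>)
    from tendsto_add[OF elim(1,2)]
    have "(\<lambda>n. real n powr (- e) * (\<Sum>i<n. off_diag (int i + 1) \<omega> + diag (int i + 1) \<omega>)) \<longlonglongrightarrow> 0"
      by (simp add: sum.distrib distrib_left)
    moreover have "real n powr (- e) * (\<Sum>i<n. off_diag (int i + 1) \<omega> + diag (int i + 1) \<omega>)
        = real n powr (1 - e) * (sample_autocov (lin_proc c \<xi>) h n \<omega> - ?\<gamma>)" for n
    proof -
      have "(\<Sum>i<n. off_diag (int i + 1) \<omega> + diag (int i + 1) \<omega>)
          = real n * (sample_autocov (lin_proc c \<xi>) h n \<omega> - ?\<gamma>)"
        unfolding sample_autocov_eq using elim(3) by simp
      moreover have "real n powr (- e) * real n = real n powr (1 - e)"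
        using powr_add[of "real n" "- e" 1] by simp
      ultimately show ?thesis by (simp flip: mult.assoc)
    qed
    ultimately show ?case by simp
  qed
qed

end

theorem theorem7:
  fixes M :: "'a measure" and \<xi> :: "int \<Rightarrow> 'a \<Rightarrow> real" and c :: "nat \<Rightarrow> real"
    and \<iota> \<alpha> \<sigma> p :: real and h :: nat
  assumes "prob_space M"
    and rv: "\<And>j. \<xi> j \<in> borel_measurable M"
    and indep: "prob_space.indep_vars M (\<lambda>_. borel) \<xi> UNIV"
    and ident: "\<And>j. distr M borel (\<xi> j) = distr M borel (\<xi> 1)"
    and mean0: "\<And>j. prob_space.expectation M (\<xi> j) = 0"
    and var: "prob_space.expectation M (\<lambda>\<omega>. (\<xi> 1 \<omega>)\<^sup>2) = \<iota>"
    and alpha: "1 < \<alpha>" "\<alpha> < 2"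
    and tail: "\<exists>C. \<forall>t\<ge>0. t powr \<alpha> * prob_space.prob M {\<omega>\<in>space M. (\<xi> 1 \<omega>)\<^sup>2 > t} \<le> C"
    and sigma: "1/2 < \<sigma>" "\<sigma> \<le> 1"
    and coeff: "\<exists>C. \<forall>l. real l powr \<sigma> * \<bar>c l\<bar> \<le> C"
    and p_pos: "0 < p"
    and p_bound: "\<sigma> < 1 \<longrightarrow> p < 1 / (2 - 2 * \<sigma>)" "p < \<alpha>" "p < 2"
  shows "AE \<omega> in M. (\<lambda>n. real n powr (1 - 1 / p) *
            (sample_autocov (lin_proc c \<xi>) h n \<omega> - \<iota> * (\<Sum>j. c j * c (j + h))))
          \<longlonglongrightarrow> 0"
proof -
  interpret prob_space M by fact
  note rv [measurable]
  obtain Ct where Ct: "\<And>t. 0 \<le> t \<Longrightarrow> t powr \<alpha> * prob {\<omega>\<in>space M. (\<xi> 1 \<omega>)\<^sup>2 > t} \<le> Ct"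
    using tail by blast
  have moment1: "integrable M (\<lambda>\<omega>. ((\<xi> 1 \<omega>)\<^sup>2) powr q)" if "0 < q" "q < \<alpha>" for q
    by (rule integrable_powr_of_tail_bound[OF _ _ Ct that]) auto
  have transfer_integrable: "integrable M (\<lambda>\<omega>. f (\<xi> j \<omega>))"
    if "integrable M (\<lambda>\<omega>. f (\<xi> 1 \<omega>))" and [measurable]: "f \<in> borel_measurable borel" for f :: "real \<Rightarrow> real" and j
    using that(1) integrable_distr_eq[of "\<xi> j" M borel f] integrable_distr_eq[of "\<xi> 1" M borel f] ident[of j] by simp
  have transfer_expectation: "expectation (\<lambda>\<omega>. f (\<xi> j \<omega>)) = expectation (\<lambda>\<omega>. f (\<xi> 1 \<omega>))"
    if [measurable]: "f \<in> borel_measurable borel" for f :: "real \<Rightarrow> real" and j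
    using integral_distr[of "\<xi> j" M borel f] integral_distr[of "\<xi> 1" M borel f] ident[of j] by simp
  have sq1: "integrable M (\<lambda>\<omega>. (\<xi> 1 \<omega>)\<^sup>2)"
    using moment1[of 1] alpha by simp
  obtain Cc where Cc: "\<And>l. real l powr \<sigma> * \<bar>c l\<bar> \<le> Cc"
    using coeff by blast
  \<comment> \<open>The first summand covers l = 0, where the given bound says nothing about
    \<open>c 0\<close>; for l >= 1 the estimate 1 + l <= 2 * l costs the factor 2 powr
    \<sigma>.\<close>
  define C where "C = \<bar>c 0\<bar> + 2 powr \<sigma> * Cc"
  have Cc0: "0 \<le> Cc"
    using Cc[of 1] by (smt (verit) abs_ge_zero mult_nonneg_nonneg powr_ge_zero)
  have coeff_le: "\<bar>c l\<bar> \<le> C * (1 + real l) powr (- \<sigma>)" for l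
  proof (cases "l = 0")
    case True
    then show ?thesis using Cc0 by (simp add: C_def)
  next
    case False
    have "(1 + real l) powr \<sigma> \<le> (2 * real l) powr \<sigma>"
      using False sigma by (intro powr_mono2) auto
    then have "(1 + real l) powr \<sigma> * \<bar>c l\<bar> \<le> (2 * real l) powr \<sigma> * \<bar>c l\<bar>"
      by (rule mult_right_mono) simp
    also have "\<dots> = 2 powr \<sigma> * (real l powr \<sigma> * \<bar>c l\<bar>)"
      by (simp add: powr_mult)
    also have "\<dots> \<le> 2 powr \<sigma> * Cc"
      by (intro mult_left_mono Cc) simp
    also have "\<dots> \<le> C"
      by (simp add: C_def)
    finally show ?thesis
      by (simp add: powr_minus field_simps)
  qed
  interpret linear_process M \<xi> c \<iota> C \<sigma> h
  proof
    show "integrable M (\<lambda>\<omega>. (\<xi> j \<omega>)\<^sup>2)" for j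
      by (rule transfer_integrable[OF sq1]) measurable
    show "expectation (\<lambda>\<omega>. (\<xi> j \<omega>)\<^sup>2) = \<iota>" for j
      unfolding var[symmetric] by (rule transfer_expectation) measurable
  qed (use indep mean0 sigma coeff_le in auto)
  \<comment> \<open>This leaves room for the working exponent \<open>e\<close>. The lower thresholds
    belong to the diagonal and off-diagonal parts; below 1 / p the rate is at least the one claimed,
    and below 1 the moment order \<open>q\<close> can exceed 1.\<close>
  have exponent: "max (1 / \<alpha>) (2 - 2 * \<sigma>) < min 1 (1 / p)"
  proof -
    \<comment> \<open>At \<sigma> = 1 the bound 1 / (2 - 2 * \<sigma>) means infinity, whereas
      division by zero yields 0; the hypothesis is therefore conditional and this case is
      immediate.\<close>
    have "2 - 2 * \<sigma> < 1 / p"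
    proof (cases "\<sigma> < 1")
      case True
      then show ?thesis
        using p_bound(1) p_pos by (simp add: field_simps)
    next
      case False
      then have "2 - 2 * \<sigma> \<le> 0" by simp
      also have "0 < 1 / p" using p_pos by simp
      finally show ?thesis .
    qed
    then show ?thesis
      using alpha sigma p_pos p_bound(2) by (simp add: field_simps)
  qed
  then obtain e where "max (1 / \<alpha>) (2 - 2 * \<sigma>) < e" "e < min 1 (1 / p)"
    using dense by blast
  then have e: "1 / \<alpha> < e" "2 - 2 * \<sigma> < e" "e < 1" "e < 1 / p"
    by auto
  have "1 / 2 < 1 / \<alpha>"
    using alpha by (simp add: field_simps)
  then have e_half: "1 / 2 < e"
    using e by linarith
  have "1 / e < \<alpha>"
    using e(1) e_half alpha by (simp add: field_simps)
  \<comment> \<open>Above 1 / e, so that linear block moments suffice for chaining; below \<alpha>,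
    so that the tail bound supplies the moment of the squares.\<close>
  then obtain q where q: "1 / e < q" "q < \<alpha>"
    using dense by blast
  have "1 < 1 / e"
    using e e_half by simp
  then have q1: "1 < q" "q \<le> 2"
    using q alpha by linarith+
  have qe: "1 < q * e"
    using q(1) e_half by (simp add: field_simps)
  have "integrable M (\<lambda>\<omega>. \<bar>(\<xi> 1 \<omega>)\<^sup>2 - \<iota>\<bar> powr q)"
  proof (rule Bochner_Integration.integrable_bound)
    show "integrable M (\<lambda>\<omega>. 2 powr q * (\<bar>(\<xi> 1 \<omega>)\<^sup>2\<bar> powr q + \<bar>\<iota>\<bar> powr q))"
      using moment1[of q] q q1 by simp
    show "AE \<omega> in M. norm (\<bar>(\<xi> 1 \<omega>)\<^sup>2 - \<iota>\<bar> powr q) \<le> norm (2 powr q * (\<bar>(\<xi> 1 \<omega>)\<^sup>2\<bar> powr q + \<bar>\<iota>\<bar> powr q))"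
    proof (rule always_eventually, rule allI)
      fix \<omega>
      show "norm (\<bar>(\<xi> 1 \<omega>)\<^sup>2 - \<iota>\<bar> powr q) \<le> norm (2 powr q * (\<bar>(\<xi> 1 \<omega>)\<^sup>2\<bar> powr q + \<bar>\<iota>\<bar> powr q))"
        using abs_diff_powr_le[of q "(\<xi> 1 \<omega>)\<^sup>2" \<iota>] q1 unfolding real_norm_def
        by (simp only: abs_of_nonneg[OF powr_ge_zero] order_trans[OF _ abs_ge_self])
    qed
  qed measurable
  then have Z: "integrable M (\<lambda>\<omega>. \<bar>(\<xi> a \<omega>)\<^sup>2 - \<iota>\<bar> powr q)" for a
    by (rule transfer_integrable) measurable
  have K: "expectation (\<lambda>\<omega>. \<bar>(\<xi> a \<omega>)\<^sup>2 - \<iota>\<bar> powr q) \<le> expectation (\<lambda>\<omega>. \<bar>(\<xi> 1 \<omega>)\<^sup>2 - \<iota>\<bar> powr q)" for a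
    by (rule eq_refl, rule transfer_expectation) measurable
  have "AE \<omega> in M. (\<lambda>n. real n powr (1 - e) *
      (sample_autocov (lin_proc c \<xi>) h n \<omega> - \<iota> * (\<Sum>j. c j * c (j + h)))) \<longlonglongrightarrow> 0"
    by (rule AE_autocov_convergence[OF q1 qe Z K]) (use e e_half in auto)
  then show ?thesis
  proof eventually_elim
    case (elim \<omega>)
    let ?d = "\<lambda>n. sample_autocov (lin_proc c \<xi>) h n \<omega> - \<iota> * (\<Sum>j. c j * c (j + h))"
    \<comment> \<open>The rate with \<open>e\<close> is stronger than the claimed one because e < 1
      / p; at n = 0 both powers are 0.\<close>
    have le: "real n powr (1 - 1 / p) \<le> real n powr (1 - e)" for n
      using e by (cases "n = 0") (auto intro!: powr_mono)
    show ?case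
    proof (rule Lim_null_comparison)
      show "\<forall>\<^sub>F n in sequentially. norm (real n powr (1 - 1 / p) * ?d n) \<le> \<bar>real n powr (1 - e) * ?d n\<bar>"
        using le by (auto simp: abs_mult intro!: always_eventually mult_right_mono)
      show "(\<lambda>n. \<bar>real n powr (1 - e) * ?d n\<bar>) \<longlonglongrightarrow> 0"
        using elim by (rule tendsto_rabs_zero)
    qed
  qed
qed

end
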